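(* Let $(U,\gamma,g)$ be a geometric structure on $U$, $(\mathcal{D}_a^{+},\mathcal{D}_a^{-})$ the $g$-compatible pair of $a$-directional covariant derivative operators associated to it, $\underset{g}{\tau}$ the metric volume pseudoscalar field and $\underset{g}{\star}$ the metric Hodge extensor field. For all $X\in\mathcal{M}(U)$, $$\underset{g}{\tau}\diamond_{g^{-1}}(\mathcal{D}^{-}\wedge X)=(-1)^{n+1}\,\mathcal{D}^{-}\lrcorner_{g^{-1}}(\underset{g}{\tau}\diamond_{g^{-1}}X),$$ $$\underset{g}{\star}^{-1}(\mathcal{D}^{-}\wedge(\underset{g}{\star}X))=-\mathcal{D}^{-}\lrcorner_{g^{-1}}\widehat{X},$$ where $\diamond_{g^{-1}}$ is the $g^{-1}$-Clifford product.
   Context: $M$ is an $n$-dimensional smooth manifold, $(U_o,\phi_o)$ a chart with coordinates $x^1,\dots,x^n$, and $U\subset U_o$ open. The canonical space $\mathcal{U}_o$ is an $n$-dimensional real vector space with basis $b_1,\dots,b_n$ and the Euclidean scalar product $b_\mu\cdot b_\nu=\delta_{\mu\nu}$, extended to $\bigwedge\mathcal{U}_o$ by $(v_1\wedge\dots\wedge v_k)\cdot(w_1\wedge\dots\wedge w_k)=\det(v_i\cdot w_j)$, different grades being orthogonal. $\mathcal{M}(U)$ denotes the smooth maps $U\to\bigwedge\mathcal{U}_o$. For $a\in\mathcal{U}_o$, $a\cdot\partial_o X=\sum_\mu(a\cdot b_\mu)\,\partial X/\partial x^\mu$; for an endomorphism field $g$, $(a\cdot\partial_og)(b)=a\cdot\partial_o(g(b))-g(a\cdot\partial_ob)$.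 On grade $k$: $\widehat X=(-1)^kX$, $\widetilde X=(-1)^{k(k-1)/2}X$. Contractions: $(X\lrcorner Y)\cdot Z=Y\cdot(\widetilde X\wedge Z)$, $(X\llcorner Y)\cdot Z=X\cdot(Z\wedge\widetilde Y)$ for all $Z$. ${}^\dagger$ is the Euclidean adjoint; $\underline t$ the exterior-algebra extension of $t$. Metric field $g$: smooth field of endomorphisms of $\mathcal{U}_o$ with $g=g^\dagger$, $\det[g]\ne0$ everywhere. Connection field $\gamma$: smooth field of bilinear maps $\mathcal{U}_o\times\mathcal{U}_o\to\mathcal{U}_o$; $\gamma_a(b)=\gamma(a,b)$. $(U,\gamma,g)$ is a geometric structure if $g\circ\gamma_a+\gamma_a^{\dagger}\circ g=a\cdot\partial_og$ for all $a$. With $\Gamma_a(X)=\sum_\mu\gamma_a(b_\mu)\wedge(b_\mu\lrcorner X)$, the associated operators are $\mathcal{D}_a^{+}X=a\cdot\partial_oX+\Gamma_a(X)$ and $\mathcal{D}_a^{-}X=a\cdot\partial_oX-\Gamma_a^{\dagger}(X)$. For vectors $v$, $v\lrcorner_{g^{-1}}X=g^{-1}(v)\lrcorner X$. The $g^{-1}$-Clifford product is the associative bilinear product on multivectors for which scalars act by multiplication and, for vectors $b$, $b\diamond_{g^{-1}}X=g^{-1}(b)\lrcorner X+b\wedge X$, $X\diamond_{g^{-1}}b=X\llcorner g^{-1}(b)+X\wedge b$. Metric covariant divergence and covariant curl: $\mathcal{D}^{-}\lrcorner_{g^{-1}}X=\sum_\mu b_\mu\lrcorner_{g^{-1}}(\mathcal{D}_{b_\mu}^{-}X)$,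 $\mathcal{D}^{-}\wedge X=\sum_\mu b_\mu\wedge(\mathcal{D}_{b_\mu}^{-}X)$. Volume: for a pair of reciprocal frame fields $(\{e_\mu\},\{e^\mu\})$ on $U$, $\tau=\sqrt{e_\wedge\cdot e_\wedge}\;e^\wedge$ with $e_\wedge=e_1\wedge\dots\wedge e_n$, $e^\wedge=e^1\wedge\dots\wedge e^n$ (so $\tau=\pm b_1\wedge\dots\wedge b_n$), and $\underset{g}{\tau}=\sqrt{|\det[g]|}\,\tau$. Metric Hodge extensor field: $\underset{g}{\star}X=\underline{g}^{-1}(\widetilde X)\lrcorner\underset{g}{\tau}$ (invertible). *)

theory Defs
  imports "HOL-Analysis.Analysis"
begin

section \<open>Smooth manifolds and smooth maps\<close>

primrec Ck_on :: "nat \<Rightarrow> 'a set \<Rightarrow> ('a::euclidean_space \<Rightarrow> 'b::real_normed_vector) \<Rightarrow> bool" where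
  "Ck_on 0 S f \<longleftrightarrow> continuous_on S f"
| "Ck_on (Suc k) S f \<longleftrightarrow> (\<forall>x\<in>S. f differentiable (at x)) \<and>
     (\<forall>v. Ck_on k S (\<lambda>x. frechet_derivative f (at x) v))"

text \<open>Only used for open \<^term>\<open>S\<close>.\<close>
definition smooth_on :: "'a set \<Rightarrow> ('a::euclidean_space \<Rightarrow> 'b::real_normed_vector) \<Rightarrow> bool" where
  "smooth_on S f \<longleftrightarrow> (\<forall>k. Ck_on k S f)"

type_synonym 'n canonical = "(real, 'n) vec"

type_synonym ('m, 'n) chart = "'m set \<times> ('m \<Rightarrow> 'n canonical)"

definition is_chart :: "('m::topological_space, 'n::finite) chart \<Rightarrow> bool" where
  "is_chart = (\<lambda>(W, \<psi>). open W \<and> open (\<psi> ` W) \<and>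
     homeomorphism W (\<psi> ` W) \<psi> (inv_into W \<psi>))"

definition chart_repr :: "('m, 'n::finite) chart \<Rightarrow> ('m \<Rightarrow> 'b) \<Rightarrow> 'n canonical \<Rightarrow> 'b" where
  "chart_repr = (\<lambda>(W, \<psi>) f. f \<circ> inv_into W \<psi>)"

text \<open>The manifold is the whole type \<^typ>\<open>'m\<close>, its dimension is \<^term>\<open>CARD('n)\<close>.
  The atlas need not be maximal.\<close>
definition smooth_atlas ::
  "('m::{t2_space, second_countable_topology}, 'n::finite) chart set \<Rightarrow> bool" where
  "smooth_atlas \<A> \<longleftrightarrow> (\<forall>c\<in>\<A>. is_chart c) \<and> (\<Union>(fst ` \<A>) = UNIV) \<and>
     (\<forall>c\<in>\<A>. \<forall>d\<in>\<A>. smooth_on (snd c ` (fst c \<inter> fst d)) (chart_repr c (snd d)))"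

definition smooth_map ::
  "('m, 'n::finite) chart set \<Rightarrow> 'm set \<Rightarrow> ('m \<Rightarrow> 'b::real_normed_vector) \<Rightarrow> bool" where
  "smooth_map \<A> U f \<longleftrightarrow> (\<forall>c\<in>\<A>. smooth_on (snd c ` (U \<inter> fst c)) (chart_repr c f))"

section \<open>Exterior algebra of the canonical space\<close>

text \<open>The canonical space is \<^typ>\<open>real ^ 'n\<close>, over a linearly ordered finite index type.
  A multivector is the family of its coefficients with respect to the blades
  \<open>b\<^sub>A = b\<^bsub>i1\<^esub> \<wedge> \<dots> \<wedge> b\<^bsub>ik\<^esub>\<close> for \<open>A = {i1 < \<dots> < ik}\<close>. The inner product of
  \<^typ>\<open>real ^ ('n set)\<close> is the one making these blades orthonormal; that this is the
  determinant extension of the scalar product of vectors, with different grades orthogonal,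
  is \<open>inner_wedge_list\<close> and \<open>inner_wedge_list_neq\<close> below.\<close>

type_synonym 'n multivector = "real ^ ('n set)"

abbreviation basis_vec :: "'n::finite \<Rightarrow> 'n canonical" (\<open>\<b>\<close>) where
  "\<b> i \<equiv> axis i 1"

definition scalar :: "real \<Rightarrow> 'n::finite multivector" where
  "scalar c = axis {} c"

definition vec1 :: "'n::finite canonical \<Rightarrow> 'n multivector" where
  "vec1 v = (\<Sum>i\<in>UNIV. axis {i} (v $ i))"

text \<open>Sign of the permutation sorting the concatenation of two increasing sequences.\<close>
definition shuffle_sign :: "'n::{finite, linorder} set \<Rightarrow> 'n set \<Rightarrow> real" where
  "shuffle_sign A B = (- 1) ^ card {(i, j). i \<in> A \<and> j \<in> B \<and> j < i}"

definition wedge ::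
  "'n::{finite, linorder} multivector \<Rightarrow> 'n multivector \<Rightarrow> 'n multivector" (infixl \<open>\<and>\<^sub>e\<close> 70) where
  "X \<and>\<^sub>e Y = (\<chi> C. \<Sum>A\<in>Pow C. shuffle_sign A (C - A) * X $ A * Y $ (C - A))"

definition wedge_list :: "'n::{finite, linorder} canonical list \<Rightarrow> 'n multivector" where
  "wedge_list vs = foldr (\<lambda>v X. vec1 v \<and>\<^sub>e X) vs (scalar 1)"

definition wedge_all :: "('n::{finite, linorder} \<Rightarrow> 'n canonical) \<Rightarrow> 'n multivector" where
  "wedge_all e = wedge_list (map e (sorted_list_of_set UNIV))"

definition grade_inv :: "'n::finite multivector \<Rightarrow> 'n multivector" where
  "grade_inv X = (\<chi> A. (- 1) ^ card A * X $ A)"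

definition reversion :: "'n::finite multivector \<Rightarrow> 'n multivector" where
  "reversion X = (\<chi> A. (- 1) ^ (card A * (card A - 1) div 2) * X $ A)"

definition lcontr ::
  "'n::{finite, linorder} multivector \<Rightarrow> 'n multivector \<Rightarrow> 'n multivector" (infixr \<open>\<lrcorner>\<close> 70) where
  "X \<lrcorner> Y = adjoint (\<lambda>Z. reversion X \<and>\<^sub>e Z) Y"

definition rcontr ::
  "'n::{finite, linorder} multivector \<Rightarrow> 'n multivector \<Rightarrow> 'n multivector" (infixl \<open>\<llcorner>\<close> 70) where
  "X \<llcorner> Y = adjoint (\<lambda>Z. Z \<and>\<^sub>e reversion Y) X"

text \<open>Exterior-algebra extension of an endomorphism.\<close>
definition ext_alg ::
  "('n::{finite, linorder} canonical \<Rightarrow> 'n canonical) \<Rightarrow> 'n multivector \<Rightarrow> 'n multivector" where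
  "ext_alg t X = (\<Sum>A\<in>UNIV. (X $ A) *\<^sub>R wedge_list (map (\<lambda>i. t (\<b> i)) (sorted_list_of_set A)))"

definition is_clifford_product ::
  "('n::{finite, linorder} canonical \<Rightarrow> 'n canonical) \<Rightarrow>
   ('n multivector \<Rightarrow> 'n multivector \<Rightarrow> 'n multivector) \<Rightarrow> bool" where
  "is_clifford_product h P \<longleftrightarrow> bilinear P \<and>
     (\<forall>X Y Z. P (P X Y) Z = P X (P Y Z)) \<and>
     (\<forall>c X. P (scalar c) X = c *\<^sub>R X \<and> P X (scalar c) = c *\<^sub>R X) \<and>
     (\<forall>v X. P (vec1 v) X = vec1 (h v) \<lrcorner> X + vec1 v \<and>\<^sub>e X \<and>
            P X (vec1 v) = X \<llcorner> vec1 (h v) + X \<and>\<^sub>e vec1 v)"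

text \<open>Well defined for self-adjoint \<^term>\<open>h\<close>: see \<open>ex1_clifford_product\<close> below.\<close>
definition clifford ::
  "('n::{finite, linorder} canonical \<Rightarrow> 'n canonical) \<Rightarrow>
   'n multivector \<Rightarrow> 'n multivector \<Rightarrow> 'n multivector" where
  "clifford h = (THE P. is_clifford_product h P)"

section \<open>Properties of the exterior algebra and existence of the Clifford product\<close>

lemma multivector_eqI: "(\<And>A. X $ A = Y $ A) \<Longrightarrow> X = Y" for X Y :: "'n::finite multivector"
  by (simp add: vec_eq_iff)

lemma multivector_expand: "X = (\<Sum>A\<in>UNIV. X $ A *\<^sub>R axis A 1)" for X :: "'n::finite multivector"
  by (subst basis_expansion[symmetric]) (simp add: scalar_mult_eq_scaleR)

lemma bilinear_wedge: "bilinear ((\<and>\<^sub>e) :: 'n::{finite, linorder} multivector \<Rightarrow> _)"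
  unfolding bilinear_def
  by (auto intro!: linearI simp: wedge_def vec_eq_iff algebra_simps sum.distrib sum_distrib_left)

lemma linear_wedge: "linear (\<lambda>X. X \<and>\<^sub>e Y)" "linear (\<lambda>Y. X \<and>\<^sub>e Y)"
  using bilinear_wedge unfolding bilinear_def by auto

lemma linear_vec1: "linear (vec1 :: 'n::finite canonical \<Rightarrow> _)"
  by (rule linearI) (auto simp: vec1_def vec_eq_iff axis_def sum.distrib[symmetric] sum_distrib_left intro!: sum.cong)

lemma shuffle_sign_empty: "shuffle_sign {} A = 1" "shuffle_sign A {} = 1"
  by (simp_all add: shuffle_sign_def)

lemma shuffle_sign_Un_left:
  fixes A B C :: "'n::{finite, linorder} set"
  assumes "A \<inter> B = {}"
  shows "shuffle_sign (A \<union> B) C = shuffle_sign A C * shuffle_sign B C"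
proof -
  have "{(i, j). i \<in> A \<union> B \<and> j \<in> C \<and> j < i} =
        {(i, j). i \<in> A \<and> j \<in> C \<and> j < i} \<union> {(i, j). i \<in> B \<and> j \<in> C \<and> j < i}" by auto
  moreover have "card \<dots> = card {(i, j). i \<in> A \<and> j \<in> C \<and> j < i} + card {(i, j). i \<in> B \<and> j \<in> C \<and> j < i}"
    by (rule card_Un_disjoint) (use assms in auto)
  ultimately show ?thesis by (simp add: shuffle_sign_def power_add)
qed

lemma shuffle_sign_Un_right:
  fixes A B C :: "'n::{finite, linorder} set"
  assumes "A \<inter> B = {}"
  shows "shuffle_sign C (A \<union> B) = shuffle_sign C A * shuffle_sign C B"
proof -
  have "{(i, j). i \<in> C \<and> j \<in> A \<union> B \<and> j < i} =
        {(i, j). i \<in> C \<and> j \<in> A \<and> j < i} \<union> {(i, j). i \<in> C \<and> j \<in> B \<and> j < i}" by auto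
  moreover have "card \<dots> = card {(i, j). i \<in> C \<and> j \<in> A \<and> j < i} + card {(i, j). i \<in> C \<and> j \<in> B \<and> j < i}"
    by (rule card_Un_disjoint) (use assms in auto)
  ultimately show ?thesis by (simp add: shuffle_sign_def power_add)
qed

lemma wedge_assoc: "(X \<and>\<^sub>e Y) \<and>\<^sub>e Z = X \<and>\<^sub>e (Y \<and>\<^sub>e Z)"
proof (rule multivector_eqI)
  fix D :: "'a set"
  have "((X \<and>\<^sub>e Y) \<and>\<^sub>e Z) $ D = (\<Sum>E\<in>Pow D. \<Sum>A\<in>Pow E.
      shuffle_sign E (D - E) * (shuffle_sign A (E - A) * X $ A * Y $ (E - A)) * Z $ (D - E))"
    by (simp add: wedge_def sum_distrib_left sum_distrib_right)
  also have "\<dots> = (\<Sum>(E, A)\<in>Sigma (Pow D) Pow.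
      shuffle_sign E (D - E) * (shuffle_sign A (E - A) * X $ A * Y $ (E - A)) * Z $ (D - E))"
    by (simp add: sum.Sigma)
  also have "\<dots> = (\<Sum>(A, B)\<in>Sigma (Pow D) (\<lambda>A. Pow (D - A)).
      shuffle_sign A (D - A) * X $ A * (shuffle_sign B (D - A - B) * Y $ B * Z $ (D - A - B)))"
  proof (rule sum.reindex_bij_witness[where i = "\<lambda>(A, B). (A \<union> B, A)" and j = "\<lambda>(E, A). (A, E - A)"], goal_cases)
    case (5 x)
    obtain E A where x: "x = (E, A)" "A \<subseteq> E" "E \<subseteq> D" using 5 by auto
    have 1: "shuffle_sign E (D - E) = shuffle_sign A (D - E) * shuffle_sign (E - A) (D - E)"
      using shuffle_sign_Un_left[of A "E - A" "D - E"] x by (simp add: Un_absorb1)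
    have "D - A = (E - A) \<union> (D - E)" using x by auto
    then have 2: "shuffle_sign A (D - A) = shuffle_sign A (E - A) * shuffle_sign A (D - E)"
      using shuffle_sign_Un_right[of "E - A" "D - E" A] by auto
    have 3: "D - A - (E - A) = D - E" using x by auto
    show ?case using x by (simp add: 1 2 3)
  qed auto
  also have "\<dots> = (\<Sum>A\<in>Pow D. \<Sum>B\<in>Pow (D - A).
      shuffle_sign A (D - A) * X $ A * (shuffle_sign B (D - A - B) * Y $ B * Z $ (D - A - B)))"
    by (simp add: sum.Sigma)
  also have "\<dots> = (X \<and>\<^sub>e (Y \<and>\<^sub>e Z)) $ D"
    by (simp add: wedge_def sum_distrib_left)
  finally show "((X \<and>\<^sub>e Y) \<and>\<^sub>e Z) $ D = (X \<and>\<^sub>e (Y \<and>\<^sub>e Z)) $ D" .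
qed

lemma wedge_scalar: "scalar c \<and>\<^sub>e X = c *\<^sub>R X" "X \<and>\<^sub>e scalar c = c *\<^sub>R X"
proof -
  have "(\<Sum>A\<in>Pow C. shuffle_sign A (C - A) * scalar c $ A * X $ (C - A)) = c * X $ C" for C
  proof -
    have "(\<Sum>A\<in>Pow C. shuffle_sign A (C - A) * scalar c $ A * X $ (C - A)) =
        (\<Sum>A\<in>Pow C. if A = {} then c * X $ C else 0)"
      by (rule sum.cong) (auto simp: scalar_def axis_def shuffle_sign_def)
    then show ?thesis by simp
  qed
  then show "scalar c \<and>\<^sub>e X = c *\<^sub>R X" by (simp add: wedge_def vec_eq_iff)
  have "(\<Sum>A\<in>Pow C. shuffle_sign A (C - A) * X $ A * scalar c $ (C - A)) = c * X $ C" for C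
  proof -
    have "(\<Sum>A\<in>Pow C. shuffle_sign A (C - A) * X $ A * scalar c $ (C - A)) =
        (\<Sum>A\<in>Pow C. if A = C then c * X $ C else 0)"
    proof (rule sum.cong)
      fix A
      assume "A \<in> Pow C"
      then have "C - A = {} \<longleftrightarrow> A = C" by auto
      then show "shuffle_sign A (C - A) * X $ A * scalar c $ (C - A) = (if A = C then c * X $ C else 0)"
        by (cases "A = C") (simp_all add: scalar_def axis_def shuffle_sign_empty)
    qed simp
    then show ?thesis by simp
  qed
  then show "X \<and>\<^sub>e scalar c = c *\<^sub>R X" by (simp add: wedge_def vec_eq_iff)
qed

lemma vec1_basis: "vec1 (\<b> i) = axis {i} 1"
proof -
  have "vec1 (\<b> i) = (\<Sum>j\<in>UNIV. if j = i then axis {i} 1 else 0)"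
    unfolding vec1_def by (rule sum.cong) (auto simp: axis_def vec_eq_iff)
  then show ?thesis by simp
qed

lemma vec1_expand: "vec1 v = (\<Sum>i\<in>UNIV. v $ i *\<^sub>R axis {i} 1)"
  by (auto simp: vec1_def vec_eq_iff axis_def intro!: sum.cong)

lemma basis_wedge_nth:
  "(axis {i} 1 \<and>\<^sub>e X) $ C = (if i \<in> C then (- 1) ^ card {c\<in>C. c < i} * X $ (C - {i}) else 0)"
proof -
  have "(axis {i} 1 \<and>\<^sub>e X) $ C =
    (\<Sum>A\<in>Pow C. if A = {i} then shuffle_sign {i} (C - {i}) * X $ (C - {i}) else 0)"
    unfolding wedge_def vec_lambda_beta by (rule sum.cong) (auto simp: axis_def)
  moreover have "{(x, j). x = i \<and> j \<in> C \<and> j \<noteq> i \<and> j < x} = Pair i ` {c\<in>C. c < i}" by auto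
  then have "shuffle_sign {i} (C - {i}) = (- 1) ^ card {c\<in>C. c < i}"
    by (simp add: shuffle_sign_def card_image inj_on_def)
  ultimately show ?thesis by simp
qed

lemma wedge_basis_nth:
  "(X \<and>\<^sub>e axis {i} 1) $ C = (if i \<in> C then (- 1) ^ card {c\<in>C. i < c} * X $ (C - {i}) else 0)"
proof -
  have "(X \<and>\<^sub>e axis {i} 1) $ C =
    (\<Sum>A\<in>Pow C. if A = C - {i} then if i \<in> C then shuffle_sign (C - {i}) {i} * X $ (C - {i}) else 0 else 0)"
    unfolding wedge_def vec_lambda_beta by (rule sum.cong) (auto simp: axis_def double_diff)
  moreover have "{(x, j). x \<in> C \<and> x \<noteq> i \<and> j = i \<and> j < x} = (\<lambda>x. (x, i)) ` {c\<in>C. i < c}" by auto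
  then have "shuffle_sign (C - {i}) {i} = (- 1) ^ card {c\<in>C. i < c}"
    by (simp add: shuffle_sign_def card_image inj_on_def)
  ultimately show ?thesis by (simp add: sum.delta)
qed

lemma reversion_vec1 [simp]: "reversion (vec1 v) = vec1 v"
proof (rule multivector_eqI)
  fix A
  have "vec1 v $ A = 0" if "card A \<noteq> 1"
    unfolding vec1_def sum_component by (rule sum.neutral) (use that in \<open>auto simp: axis_def\<close>)
  then show "reversion (vec1 v) $ A = vec1 v $ A"
    by (cases "card A = 1") (simp_all add: reversion_def)
qed

lemma linear_reversion: "linear reversion"
  by (auto intro!: linearI simp: reversion_def vec_eq_iff algebra_simps)

lemma linear_grade_inv: "linear grade_inv"
  by (auto intro!: linearI simp: grade_inv_def vec_eq_iff algebra_simps)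

lemma grade_inv_axis: "grade_inv (axis A 1) = (- 1) ^ card A *\<^sub>R axis A 1"
  by (auto simp: grade_inv_def vec_eq_iff axis_def)

lemma grade_inv_grade_inv [simp]: "grade_inv (grade_inv X) = X"
  by (simp add: grade_inv_def vec_eq_iff flip: mult.assoc power_add mult_2)

lemma grade_inv_scalar [simp]: "grade_inv (scalar c) = scalar c"
  by (auto simp: grade_inv_def scalar_def vec_eq_iff axis_def)

lemma inner_grade_inv: "grade_inv X \<bullet> Y = X \<bullet> grade_inv Y"
  by (simp add: inner_vec_def grade_inv_def algebra_simps)

lemma inner_lcontr: "(X \<lrcorner> Y) \<bullet> Z = Y \<bullet> (reversion X \<and>\<^sub>e Z)"
  unfolding lcontr_def by (simp add: adjoint_clauses linear_wedge)

lemma inner_rcontr: "(X \<llcorner> Y) \<bullet> Z = X \<bullet> (Z \<and>\<^sub>e reversion Y)"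
  unfolding rcontr_def by (simp add: adjoint_clauses linear_wedge)

lemma inner_ext: "(\<And>Z. X \<bullet> Z = Y \<bullet> Z) \<Longrightarrow> X = Y" for X Y :: "'a::real_inner"
  using vector_eq_rdot by blast

lemma linear_lcontr: "linear (\<lambda>Y. X \<lrcorner> Y)"
  by (rule linearI; rule inner_ext) (simp_all add: inner_lcontr inner_add_left)

lemma linear_lcontr_vec1: "linear (\<lambda>v. vec1 v \<lrcorner> Y)"
  by (rule linearI; rule inner_ext)
    (simp_all add: inner_lcontr inner_add_left inner_add_right linear_add[OF linear_vec1] linear_scale[OF linear_vec1]
        linear_add[OF linear_wedge(1)] linear_scale[OF linear_wedge(1)]
        linear_add[OF linear_reversion] linear_scale[OF linear_reversion])

lemma grade_inv_vec1_wedge: "grade_inv (vec1 v \<and>\<^sub>e X) = - (vec1 v \<and>\<^sub>e grade_inv X)"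
proof -
  have *: "grade_inv (axis {i} 1 \<and>\<^sub>e X) = - (axis {i} 1 \<and>\<^sub>e grade_inv X)" for i
  proof (rule multivector_eqI)
    fix C
    have "card C = Suc (card (C - {i}))" if "i \<in> C"
      using that by (metis card_Suc_Diff1 finite)
    then show "grade_inv (axis {i} 1 \<and>\<^sub>e X) $ C = (- (axis {i} 1 \<and>\<^sub>e grade_inv X)) $ C"
      by (cases "i \<in> C") (simp_all add: grade_inv_def basis_wedge_nth del: card_Diff_insert)
  qed
  show ?thesis
    by (simp add: vec1_expand linear_sum[OF linear_wedge(1)] linear_sum[OF linear_grade_inv]
        linear_scale[OF linear_grade_inv] linear_scale[OF linear_wedge(1)] * sum_negf)
qed

lemma wedge_vec1: "X \<and>\<^sub>e vec1 v = vec1 v \<and>\<^sub>e grade_inv X"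
proof -
  have *: "X \<and>\<^sub>e axis {i} 1 = axis {i} 1 \<and>\<^sub>e grade_inv X" for i
  proof (rule multivector_eqI)
    fix C
    have "(- 1) ^ card {c\<in>C. i < c} = (- 1) ^ card {c\<in>C. c < i} * (- 1 :: real) ^ card (C - {i})" if "i \<in> C"
    proof -
      have "C - {i} = {c\<in>C. i < c} \<union> {c\<in>C. c < i}" by auto
      moreover have "card \<dots> = card {c\<in>C. i < c} + card {c\<in>C. c < i}"
        by (rule card_Un_disjoint) auto
      ultimately show ?thesis by (simp add: power_add)
    qed
    then show "(X \<and>\<^sub>e axis {i} 1) $ C = (axis {i} 1 \<and>\<^sub>e grade_inv X) $ C"
      by (simp add: wedge_basis_nth basis_wedge_nth grade_inv_def)
  qed
  show ?thesis
    by (simp add: vec1_expand linear_sum[OF linear_wedge(2)] linear_sum[OF linear_wedge(1)]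
        linear_scale[OF linear_wedge(2)] linear_scale[OF linear_wedge(1)] *)
qed

lemma rcontr_vec1: "X \<llcorner> vec1 v = grade_inv (vec1 v \<lrcorner> X)"
  by (rule inner_ext) (simp add: inner_rcontr inner_lcontr wedge_vec1 inner_grade_inv)

lemma grade_inv_lcontr: "grade_inv (vec1 v \<lrcorner> X) = - (vec1 v \<lrcorner> grade_inv X)"
  by (rule inner_ext) (simp add: inner_lcontr inner_grade_inv grade_inv_vec1_wedge)

lemma basis_wedge_axis:
  fixes C :: "'n::{finite, linorder} set"
  shows "axis {i} 1 \<and>\<^sub>e axis C 1 = (if i \<in> C then 0 else (- 1) ^ card {c\<in>C. c < i} *\<^sub>R axis (insert i C) 1)"
proof (rule multivector_eqI)
  fix D :: "'n set"
  have lt: "{c \<in> insert i C. c < i} = {c\<in>C. c < i}" by auto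
  show "(axis {i} 1 \<and>\<^sub>e axis C 1) $ D =
    (if i \<in> C then 0 else (- 1) ^ card {c\<in>C. c < i} *\<^sub>R axis (insert i C) 1) $ D"
  proof (cases "i \<in> C")
    case True
    then have "C \<noteq> D - {i}" by blast
    then show ?thesis using True unfolding basis_wedge_nth by (simp add: axis_def)
  next
    case False
    show ?thesis
    proof (cases "D = insert i C")
      case True
      then show ?thesis using False lt unfolding basis_wedge_nth by (simp add: axis_def)
    next
      case D: False
      then have "\<not> (i \<in> D \<and> D - {i} = C)" by blast
      then show ?thesis using False D unfolding basis_wedge_nth by (cases "i \<in> D") (simp_all add: axis_def)
    qed
  qed
qed

lemma basis_lcontr_nth:
  "(axis {i} 1 \<lrcorner> X) $ C = (if i \<in> C then 0 else (- 1) ^ card {c\<in>C. c < i} * X $ insert i C)"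
proof -
  have "(axis {i} 1 \<lrcorner> X) $ C = X \<bullet> (axis {i} 1 \<and>\<^sub>e axis C 1)"
    using inner_lcontr[of "vec1 (\<b> i)" X "axis C 1", unfolded reversion_vec1, unfolded vec1_basis]
    by (simp add: inner_axis)
  then show ?thesis by (simp add: inner_axis basis_wedge_axis)
qed

lemma contraction_wedge:
  "vec1 v \<lrcorner> (vec1 w \<and>\<^sub>e X) = (v \<bullet> w) *\<^sub>R X - vec1 w \<and>\<^sub>e (vec1 v \<lrcorner> X)"
proof -
  have *: "axis {i} 1 \<lrcorner> (axis {j} 1 \<and>\<^sub>e X) + axis {j} 1 \<and>\<^sub>e (axis {i} 1 \<lrcorner> X) = (if i = j then X else 0)"
    for i j
  proof (rule multivector_eqI)
    fix C :: "'a set"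
    show "(axis {i} 1 \<lrcorner> (axis {j} 1 \<and>\<^sub>e X) + axis {j} 1 \<and>\<^sub>e (axis {i} 1 \<lrcorner> X)) $ C
        = (if i = j then X else 0) $ C"
    proof (cases "i = j")
      case True
      have "{c. (c = j \<or> c \<in> C) \<and> c < j} = {c\<in>C. c < j}" "{c \<in> C. c \<noteq> j \<and> c < j} = {c\<in>C. c < j}" by auto
      then show ?thesis using True
        by (auto simp: basis_lcontr_nth basis_wedge_nth insert_absorb simp flip: power_add mult.assoc mult_2)
    next
      case False
      show ?thesis
      proof (cases "j \<in> C \<and> i \<notin> C")
        case True
        have 1: "card {c\<in>insert i C. c < j} = card {c\<in>C. c < j} + (if i < j then 1 else 0)"
        proof -
          have "{c\<in>insert i C. c < j} = (if i < j then insert i {c\<in>C. c < j} else {c\<in>C. c < j})" by auto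
          then show ?thesis using True by simp
        qed
        have 2: "card {c\<in>C. c < i} = card {c\<in>C - {j}. c < i} + (if j < i then 1 else 0)"
        proof -
          have "{c\<in>C. c < i} = (if j < i then insert j {c\<in>C - {j}. c < i} else {c\<in>C - {j}. c < i})"
            using True by auto
          then show ?thesis by simp
        qed
        have 3: "insert i C - {j} = insert i (C - {j})" using False by auto
        show ?thesis using True False unfolding vector_add_component basis_lcontr_nth basis_wedge_nth 1 2 3
          by (auto simp: linorder_neq_iff)
      next
        case False': False
        then show ?thesis using False by (auto simp: basis_lcontr_nth basis_wedge_nth)
      qed
    qed
  qed
  have "vec1 v \<lrcorner> (vec1 w \<and>\<^sub>e X) + vec1 w \<and>\<^sub>e (vec1 v \<lrcorner> X) = (v \<bullet> w) *\<^sub>R X"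
  proof -
    have lv: "vec1 v \<lrcorner> Y = (\<Sum>i\<in>UNIV. v $ i *\<^sub>R (axis {i} 1 \<lrcorner> Y))" for Y :: "'a multivector"
    proof -
      have "vec1 (\<Sum>i\<in>UNIV. v $ i *\<^sub>R \<b> i) \<lrcorner> Y = (\<Sum>i\<in>UNIV. v $ i *\<^sub>R (vec1 (\<b> i) \<lrcorner> Y))"
        by (simp add: linear_sum[OF linear_lcontr_vec1] linear_scale[OF linear_lcontr_vec1])
      moreover have "(\<Sum>i\<in>UNIV. v $ i *\<^sub>R \<b> i) = v"
        using basis_expansion[of v] by (simp add: scalar_mult_eq_scaleR)
      ultimately show ?thesis by (simp add: vec1_basis)
    qed
    have lw: "vec1 w \<and>\<^sub>e Y = (\<Sum>j\<in>UNIV. w $ j *\<^sub>R (axis {j} 1 \<and>\<^sub>e Y))" for Y :: "'a multivector"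
      by (simp add: vec1_expand linear_sum[OF linear_wedge(1)] linear_scale[OF linear_wedge(1)])
    have "vec1 v \<lrcorner> (vec1 w \<and>\<^sub>e X) =
        (\<Sum>i\<in>UNIV. \<Sum>j\<in>UNIV. (v $ i * w $ j) *\<^sub>R (axis {i} 1 \<lrcorner> (axis {j} 1 \<and>\<^sub>e X)))"
      by (subst sum.swap) (simp add: lv lw linear_sum[OF linear_lcontr] linear_scale[OF linear_lcontr] scaleR_right.sum ac_simps)
    moreover have "vec1 w \<and>\<^sub>e (vec1 v \<lrcorner> X) =
        (\<Sum>i\<in>UNIV. \<Sum>j\<in>UNIV. (v $ i * w $ j) *\<^sub>R (axis {j} 1 \<and>\<^sub>e (axis {i} 1 \<lrcorner> X)))"
      by (simp add: lv lw linear_sum[OF linear_wedge(2)] linear_scale[OF linear_wedge(2)] scaleR_right.sum ac_simps)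
    ultimately have "vec1 v \<lrcorner> (vec1 w \<and>\<^sub>e X) + vec1 w \<and>\<^sub>e (vec1 v \<lrcorner> X) =
        (\<Sum>i\<in>UNIV. \<Sum>j\<in>UNIV. (v $ i * w $ j) *\<^sub>R (if i = j then X else 0))"
      by (simp add: sum.distrib[symmetric] scaleR_add_right[symmetric] *)
    also have "\<dots> = (\<Sum>i\<in>UNIV. (v $ i * w $ i) *\<^sub>R X)"
      by (simp add: if_distrib[where f = "\<lambda>Y. _ *\<^sub>R Y"] cong: if_cong)
    also have "\<dots> = (v \<bullet> w) *\<^sub>R X" by (simp add: inner_vec_def scaleR_left.sum)
    finally show ?thesis .
  qed
  then show ?thesis by (simp add: algebra_simps)
qed

lemma lcontr_scalar: "vec1 v \<lrcorner> scalar c = 0"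
proof (rule inner_ext)
  fix Z
  show "(vec1 v \<lrcorner> scalar c) \<bullet> Z = 0 \<bullet> Z"
    unfolding inner_lcontr reversion_vec1 unfolding vec1_expand
    by (simp add: scalar_def inner_axis' linear_sum[OF linear_wedge(1)]
       linear_scale[OF linear_wedge(1)] basis_wedge_nth sum_component)
qed

lemma vec1_wedge_vec1: "vec1 v \<and>\<^sub>e vec1 w = - (vec1 w \<and>\<^sub>e vec1 v)"
proof -
  have "grade_inv (vec1 v) = - vec1 v" for v :: "'a canonical"
  proof (rule multivector_eqI)
    fix A
    have "vec1 v $ A = 0" if "card A \<noteq> 1"
      unfolding vec1_def sum_component by (rule sum.neutral) (use that in \<open>auto simp: axis_def\<close>)
    then show "grade_inv (vec1 v) $ A = (- vec1 v) $ A"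
      by (cases "card A = 1") (simp_all add: grade_inv_def)
  qed
  then show ?thesis
    by (subst wedge_vec1) (simp add: linear_neg[OF linear_wedge(2)])
qed

lemma rcontr_wedge:
  "(X \<and>\<^sub>e vec1 w) \<llcorner> vec1 v = (v \<bullet> w) *\<^sub>R X - (X \<llcorner> vec1 v) \<and>\<^sub>e vec1 w"
  by (simp add: rcontr_vec1 wedge_vec1 grade_inv_lcontr contraction_wedge grade_inv_vec1_wedge
      linear_diff[OF linear_grade_inv] linear_scale[OF linear_grade_inv] linear_neg[OF linear_wedge(2)]
      linear_neg[OF linear_lcontr] linear_neg[OF linear_grade_inv])

lemma wedge_list_Nil [simp]: "wedge_list [] = scalar 1"
  by (simp add: wedge_list_def)

lemma wedge_list_Cons: "wedge_list (v # vs) = vec1 v \<and>\<^sub>e wedge_list vs"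
  by (simp add: wedge_list_def)

lemma wedge_list_snoc: "wedge_list (vs @ [v]) = wedge_list vs \<and>\<^sub>e vec1 v"
  by (induction vs) (simp_all add: wedge_list_Cons wedge_assoc wedge_scalar)

lemma wedge_list_grade: "wedge_list vs $ A \<noteq> 0 \<Longrightarrow> card A = length vs"
proof (induction vs arbitrary: A)
  case Nil
  then show ?case by (auto simp: scalar_def axis_def split: if_splits)
next
  case (Cons v vs)
  have "(\<Sum>i\<in>UNIV. v $ i *\<^sub>R (axis {i} 1 \<and>\<^sub>e wedge_list vs)) $ A \<noteq> 0"
    using Cons.prems
    by (simp add: wedge_list_Cons vec1_expand linear_sum[OF linear_wedge(1)] linear_scale[OF linear_wedge(1)])
  then obtain i where "(axis {i} 1 \<and>\<^sub>e wedge_list vs) $ A \<noteq> 0"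
    by (force simp: sum_component dest: sum.not_neutral_contains_not_neutral)
  then have "i \<in> A" "wedge_list vs $ (A - {i}) \<noteq> 0"
    by (auto simp: basis_wedge_nth split: if_splits)
  then show ?case using Cons.IH[of "A - {i}"] by (auto simp: card_Suc_Diff1[symmetric] simp del: card_Diff_insert card_Diff_singleton)
qed

lemma inner_wedge_list_neq: "length vs \<noteq> length ws \<Longrightarrow> wedge_list vs \<bullet> wedge_list ws = 0"
  unfolding inner_vec_def by (rule sum.neutral) (metis inner_zero_left inner_zero_right wedge_list_grade)

lemma rcontr_wedge_list:
  "(\<Sum>b<k. (u \<bullet> w b) *\<^sub>R wedge_list (map (w(b := y)) [0..<k])) =
   (wedge_list (map w [0..<k]) \<llcorner> vec1 u) \<and>\<^sub>e vec1 y"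
proof (induction k)
  case 0
  have "scalar 1 \<llcorner> vec1 u = 0"
    by (simp add: rcontr_vec1 lcontr_scalar linear_0[OF linear_grade_inv])
  then show ?case by (simp add: linear_0[OF linear_wedge(1)])
next
  case (Suc k)
  have "(\<Sum>b<Suc k. (u \<bullet> w b) *\<^sub>R wedge_list (map (w(b := y)) [0..<Suc k])) =
    (\<Sum>b<k. (u \<bullet> w b) *\<^sub>R wedge_list (map (w(b := y)) [0..<k])) \<and>\<^sub>e vec1 (w k) +
    (u \<bullet> w k) *\<^sub>R (wedge_list (map w [0..<k]) \<and>\<^sub>e vec1 y)"
  proof -
    have "map (w(k := y)) [0..<k] = map w [0..<k]" by simp
    then show ?thesis
      by (simp add: wedge_list_snoc linear_sum[OF linear_wedge(1)] linear_scale[OF linear_wedge(1)])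
  qed
  also have "\<dots> = (wedge_list (map w [0..<Suc k]) \<llcorner> vec1 u) \<and>\<^sub>e vec1 y"
    by (simp add: Suc wedge_list_snoc rcontr_wedge linear_diff[OF linear_wedge(1)] linear_scale[OF linear_wedge(1)]
        wedge_assoc vec1_wedge_vec1[of y "w k"] linear_neg[OF linear_wedge(2)])
  finally show ?case .
qed

text \<open>The right-hand side is \<open>det (v i \<bullet> w j)\<close>, written out because \<open>k\<close> varies.\<close>
lemma inner_wedge_list:
  "wedge_list (map v [0..<k]) \<bullet> wedge_list (map w [0..<k]) =
     (\<Sum>p | p permutes {..<k}. of_int (sign p) * (\<Prod>i<k. v i \<bullet> w (p i)))"
proof (induction k arbitrary: w)
  case 0
  then show ?case by (simp add: scalar_def inner_axis_axis)
next
  case (Suc k)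
  have IH': "wedge_list (map v [0..<k]) \<bullet> wedge_list (map (w \<circ> Transposition.transpose k b) [0..<k]) =
     (\<Sum>p | p permutes {..<k}. of_int (sign p) * (\<Prod>i<k. v i \<bullet> w (Transposition.transpose k b (p i))))" for b
    by (simp add: Suc.IH)
  have wb: "map (w \<circ> Transposition.transpose k b) [0..<k] = map (w(b := w k)) [0..<k]" if "b < k" for b
    using that by (auto simp: Transposition.transpose_def)
  have wk: "map (w \<circ> Transposition.transpose k k) [0..<k] = map w [0..<k]" by simp
  let ?V = "wedge_list (map v [0..<k])"
  have "wedge_list (map v [0..<Suc k]) \<bullet> wedge_list (map w [0..<Suc k]) =
      ?V \<bullet> ((wedge_list (map w [0..<k]) \<and>\<^sub>e vec1 (w k)) \<llcorner> vec1 (v k))"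
    by (simp add: wedge_list_snoc inner_rcontr inner_commute[of ?V])
      (simp add: inner_commute)
  also have "\<dots> = (v k \<bullet> w k) * (?V \<bullet> wedge_list (map w [0..<k]))
      - (\<Sum>b<k. (v k \<bullet> w b) * (?V \<bullet> wedge_list (map (w(b := w k)) [0..<k])))"
    by (simp add: rcontr_wedge inner_diff_right flip: rcontr_wedge_list) (simp add: inner_sum_right)
  also have "\<dots> = (\<Sum>b\<in>insert k {..<k}. (if b = k then 1 else - 1) * (v k \<bullet> w b) *
       (?V \<bullet> wedge_list (map (w \<circ> Transposition.transpose k b) [0..<k])))"
    by (simp add: wb sum_negf[symmetric] del: map_map)
  also have "\<dots> = (\<Sum>b\<in>insert k {..<k}. \<Sum>p | p permutes {..<k}.
       of_int (sign (Transposition.transpose k b \<circ> p)) * (\<Prod>i<Suc k. v i \<bullet> w ((Transposition.transpose k b \<circ> p) i)))"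
  proof (rule sum.cong[OF refl])
    fix b
    have "of_int (sign (Transposition.transpose k b \<circ> p)) * (\<Prod>i<Suc k. v i \<bullet> w ((Transposition.transpose k b \<circ> p) i)) =
        (if b = k then 1 else - 1) * (v k \<bullet> w b) *
        (of_int (sign p) * (\<Prod>i<k. v i \<bullet> w (Transposition.transpose k b (p i))))" if "p permutes {..<k}" for p
    proof -
      have "p k = k" using that by (simp add: permutes_not_in)
      moreover have "sign (Transposition.transpose k b \<circ> p) = (if b = k then 1 else - 1) * sign p"
        using permutes_imp_permutation[OF _ that]
        by (simp add: sign_compose permutation_swap_id sign_swap_id)
      ultimately show ?thesis by simp
    qed
    note term_eq = this
    show "(if b = k then 1 else - 1) * (v k \<bullet> w b) * (?V \<bullet> wedge_list (map (w \<circ> Transposition.transpose k b) [0..<k])) =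
       (\<Sum>p | p permutes {..<k}. of_int (sign (Transposition.transpose k b \<circ> p)) *
         (\<Prod>i<Suc k. v i \<bullet> w ((Transposition.transpose k b \<circ> p) i)))"
      unfolding IH' sum_distrib_left by (rule sum.cong[OF refl], rule term_eq[symmetric]) simp
  qed
  also have "\<dots> = (\<Sum>p | p permutes insert k {..<k}. of_int (sign p) * (\<Prod>i<Suc k. v i \<bullet> w (p i)))"
    by (rule sum_over_permutations_insert[symmetric]) auto
  finally show ?case by (simp add: lessThan_Suc)
qed

lemma wedge_list_basis: "wedge_list (map \<b> (sorted_list_of_set A)) = axis A 1"
proof -
  have "wedge_list (map \<b> xs) = axis (set xs) 1" if "sorted xs" "distinct xs" for xs :: "'n::{finite, linorder} list"
    using that
  proof (induction xs)
    case Nil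
    then show ?case by (simp add: scalar_def)
  next
    case (Cons x xs)
    have *: "{c \<in> set xs. c < x} = {}" "x \<notin> set xs" using Cons.prems by auto
    then show ?case using Cons by (simp add: wedge_list_Cons vec1_basis basis_wedge_axis del: Collect_empty_eq)
  qed
  from this[of "sorted_list_of_set A"] show ?thesis by simp
qed

lemma lcontr_lcontr_commute:
  "(vec1 v \<lrcorner> (vec1 w \<lrcorner> X)) = - (vec1 w \<lrcorner> (vec1 v \<lrcorner> X))"
  by (rule inner_ext)
    (simp add: inner_lcontr wedge_assoc[symmetric] vec1_wedge_vec1[of w v] linear_neg[OF linear_wedge(1)])

text \<open>\<open>1\<close> generates the exterior algebra under the operators \<open>X \<mapsto> k i \<lrcorner> X' + b\<^sub>i \<and> X'\<close>
  where \<open>X'\<close> is \<open>X\<close> or its grade involution.\<close>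
lemma multivector_generated:
  fixes S :: "'n::{finite, linorder} multivector set"
  assumes S: "subspace S" "scalar 1 \<in> S"
    and G: "\<And>A. G (axis A 1) = \<sigma> A *\<^sub>R axis A 1" "\<And>A. \<sigma> A \<noteq> (0::real)"
    and cl: "\<And>i X. X \<in> S \<Longrightarrow> vec1 (k i) \<lrcorner> G X + vec1 (\<b> i) \<and>\<^sub>e G X \<in> S"
  shows "X \<in> S"
proof -
  have "X \<in> S" if "\<And>A. X $ A \<noteq> 0 \<Longrightarrow> card A \<le> d" for d and X :: "'n multivector"
    using that
  proof (induction d arbitrary: X)
    case 0
    then have "X $ A = 0" if "A \<noteq> {}" for A using that by fastforce
    then have "X = X $ {} *\<^sub>R scalar 1" by (simp add: vec_eq_iff scalar_def axis_def)
    then show ?case using S by (metis subspace_scale)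
  next
    case (Suc d)
    have "axis A 1 \<in> S" if A: "card A \<le> Suc d" for A
    proof (cases "card A \<le> d")
      case True
      then show ?thesis by (intro Suc.IH) (auto simp: axis_def split: if_splits)
    next
      case False
      then have cA: "card A = Suc d" using A by simp
      then have "A \<noteq> {}" by auto
      define i where "i = Min A"
      define B where "B = A - {i}"
      have iA: "i \<in> A" unfolding i_def using \<open>A \<noteq> {}\<close> by simp
      have AB: "A = insert i B" "i \<notin> B" "card B = d" using iA cA by (auto simp: B_def)
      have "\<not> c < i" if "c \<in> B" for c
        using that Min_le[of A c] unfolding i_def[symmetric] by (simp add: B_def not_less)
      then have "{c \<in> B. c < i} = {}" by blast
      then have e: "vec1 (\<b> i) \<and>\<^sub>e axis B 1 = axis A 1"
        using AB by (simp add: vec1_basis basis_wedge_axis del: Collect_empty_eq)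
      have B: "axis B 1 \<in> S" by (intro Suc.IH) (use AB in \<open>auto simp: axis_def split: if_splits\<close>)
      have "vec1 (k i) \<lrcorner> axis B 1 \<in> S"
      proof (rule Suc.IH)
        fix C
        assume "(vec1 (k i) \<lrcorner> axis B 1) $ C \<noteq> 0"
        then have "axis B 1 \<bullet> (vec1 (k i) \<and>\<^sub>e axis C 1) \<noteq> 0"
          using inner_lcontr[of "vec1 (k i)" "axis B 1" "axis C 1", unfolded reversion_vec1]
          by (simp add: inner_axis)
        then have "(\<Sum>j\<in>UNIV. k i $ j *\<^sub>R (axis {j} 1 \<and>\<^sub>e axis C (1::real))) $ B \<noteq> 0"
          by (simp add: inner_axis' vec1_expand linear_sum[OF linear_wedge(1)] linear_scale[OF linear_wedge(1)])
        then obtain j where "(axis {j} 1 \<and>\<^sub>e axis C (1::real)) $ B \<noteq> 0"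
          by (force simp: sum_component dest: sum.not_neutral_contains_not_neutral)
        then have "B - {j} = C"
            unfolding basis_wedge_nth by (simp add: axis_def split: if_splits)
        then show "card C \<le> d" using AB(3) by (metis card_Diff1_le)
      qed
      moreover have "vec1 (k i) \<lrcorner> G (axis B 1) + vec1 (\<b> i) \<and>\<^sub>e G (axis B 1) =
          \<sigma> B *\<^sub>R (vec1 (k i) \<lrcorner> axis B 1) + \<sigma> B *\<^sub>R axis A 1"
        by (simp add: G linear_scale[OF linear_lcontr] linear_scale[OF linear_wedge(2)] e)
      ultimately have "\<sigma> B *\<^sub>R axis A 1 \<in> S"
        using cl[OF B, of i] S(1) by (metis add_diff_cancel_left' subspace_diff subspace_scale)
      then have "(1 / \<sigma> B) *\<^sub>R \<sigma> B *\<^sub>R axis A 1 \<in> S" using S(1) by (metis subspace_scale)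
      then show ?thesis using G(2) by simp
    qed
    then have "X $ A *\<^sub>R axis A 1 \<in> S" for A
      using Suc.prems[of A] S(1) by (cases "X $ A = 0") (auto simp: subspace_0 subspace_scale)
    then have "(\<Sum>A\<in>UNIV. X $ A *\<^sub>R axis A 1) \<in> S" by (intro subspace_sum S(1))
    then show ?case using multivector_expand[of X] by simp
  qed
  from this[of _ "CARD('n)"] show ?thesis by (simp add: card_mono)
qed

lemma ex1_clifford_product:
  fixes h :: "'n::{finite, linorder} canonical \<Rightarrow> 'n canonical"
  assumes h: "linear h" "\<And>v w. h v \<bullet> w = v \<bullet> h w"
  shows "\<exists>!P. is_clifford_product h P"
proof (rule ex_ex1I)
  define L where "L v X = vec1 (h v) \<lrcorner> X + vec1 v \<and>\<^sub>e X" for v and X :: "'n multivector"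
  define R where "R v X = X \<llcorner> vec1 (h v) + X \<and>\<^sub>e vec1 v" for v and X :: "'n multivector"
  note lin = linear_wedge linear_lcontr linear_grade_inv
  note [simp] = lin[THEN linear_add] lin[THEN linear_diff] lin[THEN linear_neg] lin[THEN linear_scale]
  have linL: "linear (L v)" for v
    by (rule linearI) (simp_all add: L_def algebra_simps)
  have R: "R v X = vec1 (- h v) \<lrcorner> grade_inv X + vec1 v \<and>\<^sub>e grade_inv X" for v X
    by (simp add: R_def rcontr_vec1 grade_inv_lcontr wedge_vec1 linear_neg[OF linear_lcontr_vec1])
  have R1: "R v (scalar 1) = vec1 v" and L1: "L v (scalar 1) = vec1 v" for v
    by (simp_all add: R_def L_def rcontr_vec1 lcontr_scalar wedge_scalar linear_0[OF linear_grade_inv])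
  have LR: "L v (R w X) = R w (L v X)" for v w X
  proof -
    have 1: "h w \<bullet> v = h v \<bullet> w" by (metis h(2) inner_commute)
    have 2: "vec1 v \<and>\<^sub>e (vec1 w \<and>\<^sub>e Y) = - (vec1 w \<and>\<^sub>e (vec1 v \<and>\<^sub>e Y))" for Y
      by (simp add: wedge_assoc[symmetric] vec1_wedge_vec1[of v w])
    have R': "R w Y = - (vec1 (h w) \<lrcorner> grade_inv Y) + vec1 w \<and>\<^sub>e grade_inv Y" for Y
      by (simp add: R linear_neg[OF linear_lcontr_vec1])
    show ?thesis
      unfolding R' L_def
      by (simp add: contraction_wedge grade_inv_vec1_wedge grade_inv_lcontr 1 2
          lcontr_lcontr_commute[of "h v" "h w"])
  qed
  have genL: "X \<in> S" if "subspace S" "scalar 1 \<in> S" "\<And>v X. X \<in> S \<Longrightarrow> L v X \<in> S" for S X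
    by (rule multivector_generated[of S "\<lambda>X. X" "\<lambda>_. 1" "\<lambda>i. h (\<b> i)"])
      (use that in \<open>auto simp: L_def\<close>)
  have genR: "X \<in> S" if "subspace S" "scalar 1 \<in> S" "\<And>v X. X \<in> S \<Longrightarrow> R v X \<in> S" for S X
    by (rule multivector_generated[of S grade_inv "\<lambda>A. (- 1) ^ card A" "\<lambda>i. - h (\<b> i)"])
      (use that in \<open>auto simp: R[symmetric] grade_inv_axis\<close>)
  define com where "com a \<longleftrightarrow> linear a \<and> (\<forall>w X. a (R w X) = R w (a X))" for a
  have linR: "linear (R v)" for v
    by (rule linearI) (simp_all add: R algebra_simps)
  have com_eq: "a = b" if "com a" "com b" "a (scalar 1) = b (scalar 1)" for a b
  proof
    fix X
    have "X \<in> {X. a X = b X}"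
      by (rule genR) (use that in \<open>auto simp: com_def subspace_def linear_0 linear_add linear_scale\<close>)
    then show "a X = b X" by simp
  qed
  have com_id: "com (\<lambda>X. c *\<^sub>R X)" for c
    by (auto simp: com_def linear_scale[OF linR] intro!: linearI simp: algebra_simps)
  have com_add: "com (\<lambda>X. a X + b X)" if "com a" "com b" for a b
    using that by (auto simp: com_def linear_add[OF linR] intro: linear_compose_add)
  have com_scale: "com (\<lambda>X. c *\<^sub>R a X)" if "com a" for a c
    using that by (auto simp: com_def linear_scale[OF linR] intro: linear_compose_scale_right)
  have com_comp: "com (\<lambda>X. a (b X))" if "com a" "com b" for a b
    using that linear_compose[of b a] by (auto simp: com_def o_def)
  have com_L: "com (L v)" for v by (simp add: com_def LR linL)
  have "X \<in> {a (scalar 1) | a. com a}" for X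
  proof (rule genL)
    show "subspace {a (scalar 1) | a. com a}"
    proof (rule subspaceI)
      show "0 \<in> {a (scalar 1) | a. com a}"
        by (rule CollectI, rule exI[of _ "\<lambda>X. 0 *\<^sub>R X"]) (use com_id[of 0] in simp)
    next
      fix X Y
      assume "X \<in> {a (scalar 1) | a. com a}" "Y \<in> {a (scalar 1) | a. com a}"
      then obtain a b where "com a" "X = a (scalar 1)" "com b" "Y = b (scalar 1)" by blast
      then show "X + Y \<in> {a (scalar 1) | a. com a}" 
        by (intro CollectI exI[of _ "\<lambda>X. a X + b X"]) (simp add: com_add)
    next
      fix c X
      assume "X \<in> {a (scalar 1) | a. com a}"
      then obtain a where "com a" "X = a (scalar 1)" by blast
      then show "c *\<^sub>R X \<in> {a (scalar 1) | a. com a}" 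
        by (intro CollectI exI[of _ "\<lambda>X. c *\<^sub>R a X"]) (simp add: com_scale)
    qed
    show "scalar 1 \<in> {a (scalar 1) | a. com a}"
      by (rule CollectI, rule exI[of _ "\<lambda>X. 1 *\<^sub>R X"]) (use com_id[of 1] in simp)
    show "L v X \<in> {a (scalar 1) | a. com a}" if X: "X \<in> {a (scalar 1) | a. com a}" for v X
    proof -
      obtain a where "com a" "X = a (scalar 1)" using X by blast
      then show ?thesis 
        by (intro CollectI exI[of _ "\<lambda>X. L v (a X)"]) (simp add: com_comp[OF com_L])
    qed
  qed
  then have "\<exists>a. X = a (scalar 1) \<and> com a" for X
    by (rule CollectD)
  then have "\<forall>X. \<exists>a. X = a (scalar 1) \<and> com a" by (rule allI)
  then have "\<exists>P. \<forall>X. X = P X (scalar 1) \<and> com (P X)" by (rule choice)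
  then obtain P where "\<forall>X. X = P X (scalar 1) \<and> com (P X)" by (rule exE)
  then have P: "com (P X)" "P X (scalar 1) = X" for X by (metis, metis)
  have P_eq: "P X = a" if "com a" "a (scalar 1) = X" for a X
    by (rule com_eq) (simp_all add: that P)
  have lin_P: "linear (P X)" and R_P: "P X (R w Y) = R w (P X Y)" for X Y w
    using P(1)[of X] by (simp_all add: com_def)
  have P_add: "P (X + Y) = (\<lambda>Z. P X Z + P Y Z)" for X Y
    by (rule P_eq, rule com_add) (simp_all add: P)
  have P_scale: "P (c *\<^sub>R X) = (\<lambda>Z. c *\<^sub>R P X Z)" for c X
    by (rule P_eq, rule com_scale) (simp_all add: P)
  have "linear (\<lambda>X. P X Y)" for Y
    by (rule linearI) (simp_all add: P_add P_scale)
  then have "bilinear P"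
    using lin_P by (simp add: bilinear_def)
  moreover have "P (P X Y) = (\<lambda>Z. P X (P Y Z))" for X Y
    by (rule P_eq, rule com_comp) (simp_all add: P)
  moreover have "P (scalar c) X = c *\<^sub>R X" "P X (scalar c) = c *\<^sub>R X" for c X
  proof -
    have sc: "scalar c = c *\<^sub>R scalar 1"
      by (auto simp: scalar_def vec_eq_iff axis_def)
    have "P (scalar c) = (\<lambda>X. c *\<^sub>R X)"
      by (rule P_eq, rule com_id) (rule sc[symmetric])
    then show "P (scalar c) X = c *\<^sub>R X" by simp
    show "P X (scalar c) = c *\<^sub>R X"
      by (subst sc) (simp add: linear_scale[OF lin_P] P(2))
  qed
  moreover have "P (vec1 v) = L v" for v
    by (rule P_eq, rule com_L) (rule L1)
  moreover have "P X (vec1 v) = R v X" for v X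
    using R_P[of X v "scalar 1"] by (simp add: R1 P(2))
  ultimately have "is_clifford_product h P"
    by (simp add: is_clifford_product_def L_def R_def)
  then show "\<exists>P. is_clifford_product h P" by blast
  fix P Q
  assume PQ: "is_clifford_product h P" "is_clifford_product h Q"
  have "X \<in> {X. \<forall>Y. P X Y = Q X Y}" for X
  proof (rule genL)
    show "subspace {X. \<forall>Y. P X Y = Q X Y}"
      using PQ by (auto simp: subspace_def is_clifford_product_def bilinear_lzero bilinear_ladd bilinear_lmul)
    show "scalar 1 \<in> {X. \<forall>Y. P X Y = Q X Y}"
      using PQ by (simp add: is_clifford_product_def)
    fix v X
    assume X: "X \<in> {X. \<forall>Y. P X Y = Q X Y}"
    have "P (L v X) Y = L v (P X Y)" "Q (L v X) Y = L v (Q X Y)" for Y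
      using PQ unfolding is_clifford_product_def L_def by metis+
    then show "L v X \<in> {X. \<forall>Y. P X Y = Q X Y}" using X by simp
  qed
  then show "P = Q" by (simp add: fun_eq_iff)
qed

section \<open>Directional derivatives in the chart\<close>

definition partial_deriv ::
  "('m, 'n::finite) chart \<Rightarrow> 'n \<Rightarrow> ('m \<Rightarrow> 'b::real_normed_vector) \<Rightarrow> 'm \<Rightarrow> 'b" where
  "partial_deriv c \<mu> X p = frechet_derivative (chart_repr c X) (at (snd c p)) (\<b> \<mu>)"

definition dir_deriv ::
  "('m, 'n::finite) chart \<Rightarrow> 'n canonical \<Rightarrow> ('m \<Rightarrow> 'b::real_normed_vector) \<Rightarrow> 'm \<Rightarrow> 'b" where
  "dir_deriv c a X p = (\<Sum>\<mu>\<in>UNIV. (a \<bullet> \<b> \<mu>) *\<^sub>R partial_deriv c \<mu> X p)"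

definition endo_dir_deriv ::
  "('m, 'n::finite) chart \<Rightarrow> 'n canonical \<Rightarrow> ('m \<Rightarrow> 'n canonical \<Rightarrow>\<^sub>L 'n canonical) \<Rightarrow>
   ('m \<Rightarrow> 'n canonical) \<Rightarrow> 'm \<Rightarrow> 'n canonical" where
  "endo_dir_deriv c a t b p = dir_deriv c a (\<lambda>q. t q (b q)) p - t p (dir_deriv c a b p)"

section \<open>Geometric structures and covariant derivatives\<close>

type_synonym ('m, 'n) endo_field = "'m \<Rightarrow> 'n canonical \<Rightarrow>\<^sub>L 'n canonical"
type_synonym ('m, 'n) connection = "'m \<Rightarrow> 'n canonical \<Rightarrow>\<^sub>L 'n canonical \<Rightarrow>\<^sub>L 'n canonical"

definition metric_field ::
  "('m, 'n::finite) chart set \<Rightarrow> 'm set \<Rightarrow> ('m, 'n) endo_field \<Rightarrow> bool" where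
  "metric_field \<A> U g \<longleftrightarrow> smooth_map \<A> U g \<and>
     (\<forall>p\<in>U. adjoint (blinfun_apply (g p)) = blinfun_apply (g p) \<and>
             det (matrix (blinfun_apply (g p))) \<noteq> 0)"

definition geometric_structure ::
  "('m, 'n::finite) chart set \<Rightarrow> ('m, 'n) chart \<Rightarrow> 'm set \<Rightarrow>
   ('m, 'n) connection \<Rightarrow> ('m, 'n) endo_field \<Rightarrow> bool" where
  "geometric_structure \<A> c U \<gamma> g \<longleftrightarrow> smooth_map \<A> U \<gamma> \<and> metric_field \<A> U g \<and>
     (\<forall>p\<in>U. \<forall>a b. g p (\<gamma> p a b) + adjoint (blinfun_apply (\<gamma> p a)) (g p b)
                    = endo_dir_deriv c a g (\<lambda>_. b) p)"

definition conn_ext ::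
  "('n::{finite, linorder} canonical \<Rightarrow> 'n canonical) \<Rightarrow> 'n multivector \<Rightarrow> 'n multivector" where
  "conn_ext t X = (\<Sum>\<mu>\<in>UNIV. vec1 (t (\<b> \<mu>)) \<and>\<^sub>e (vec1 (\<b> \<mu>) \<lrcorner> X))"

type_synonym ('m, 'n) mv_operator =
  "'n canonical \<Rightarrow> ('m \<Rightarrow> 'n multivector) \<Rightarrow> 'm \<Rightarrow> 'n multivector"

definition cov_plus ::
  "('m, 'n::{finite, linorder}) chart \<Rightarrow> ('m, 'n) connection \<Rightarrow> ('m, 'n) mv_operator" where
  "cov_plus c \<gamma> a X p = dir_deriv c a X p + conn_ext (\<gamma> p a) (X p)"

definition cov_minus ::
  "('m, 'n::{finite, linorder}) chart \<Rightarrow> ('m, 'n) connection \<Rightarrow> ('m, 'n) mv_operator" where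
  "cov_minus c \<gamma> a X p = dir_deriv c a X p - adjoint (conn_ext (\<gamma> p a)) (X p)"

abbreviation inv_metric :: "('m, 'n::finite) endo_field \<Rightarrow> 'm \<Rightarrow> 'n canonical \<Rightarrow> 'n canonical" where
  "inv_metric g p \<equiv> inv (blinfun_apply (g p))"

definition metric_divergence ::
  "('m, 'n::{finite, linorder}) endo_field \<Rightarrow> ('m, 'n) mv_operator \<Rightarrow>
   ('m \<Rightarrow> 'n multivector) \<Rightarrow> 'm \<Rightarrow> 'n multivector" where
  "metric_divergence g D X p = (\<Sum>\<mu>\<in>UNIV. vec1 (inv_metric g p (\<b> \<mu>)) \<lrcorner> D (\<b> \<mu>) X p)"

definition cov_curl ::
  "('m, 'n::{finite, linorder}) mv_operator \<Rightarrow> ('m \<Rightarrow> 'n multivector) \<Rightarrow> 'm \<Rightarrow> 'n multivector" where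
  "cov_curl D X p = (\<Sum>\<mu>\<in>UNIV. vec1 (\<b> \<mu>) \<and>\<^sub>e D (\<b> \<mu>) X p)"

section \<open>Volume pseudoscalar and Hodge extensor fields\<close>

text \<open>Biorthogonality forces both families to be bases at every point.\<close>
definition reciprocal_frames ::
  "('m, 'n::finite) chart set \<Rightarrow> 'm set \<Rightarrow>
   ('n \<Rightarrow> 'm \<Rightarrow> 'n canonical) \<Rightarrow> ('n \<Rightarrow> 'm \<Rightarrow> 'n canonical) \<Rightarrow> bool" where
  "reciprocal_frames \<A> U e e' \<longleftrightarrow>
     (\<forall>\<mu>. smooth_map \<A> U (e \<mu>) \<and> smooth_map \<A> U (e' \<mu>)) \<and>
     (\<forall>p\<in>U. \<forall>\<mu> \<nu>. e \<mu> p \<bullet> e' \<nu> p = (if \<mu> = \<nu> then 1 else 0))"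

definition volume ::
  "('n::{finite, linorder} \<Rightarrow> 'm \<Rightarrow> 'n canonical) \<Rightarrow> ('n \<Rightarrow> 'm \<Rightarrow> 'n canonical) \<Rightarrow> 'm \<Rightarrow> 'n multivector" where
  "volume e e' p =
     sqrt (wedge_all (\<lambda>\<mu>. e \<mu> p) \<bullet> wedge_all (\<lambda>\<mu>. e \<mu> p)) *\<^sub>R wedge_all (\<lambda>\<mu>. e' \<mu> p)"

definition metric_volume ::
  "('m, 'n::{finite, linorder}) endo_field \<Rightarrow> ('n \<Rightarrow> 'm \<Rightarrow> 'n canonical) \<Rightarrow> ('n \<Rightarrow> 'm \<Rightarrow> 'n canonical) \<Rightarrow>
   'm \<Rightarrow> 'n multivector" where
  "metric_volume g e e' p = sqrt \<bar>det (matrix (blinfun_apply (g p)))\<bar> *\<^sub>R volume e e' p"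

definition metric_hodge ::
  "('m, 'n::{finite, linorder}) endo_field \<Rightarrow> ('n \<Rightarrow> 'm \<Rightarrow> 'n canonical) \<Rightarrow> ('n \<Rightarrow> 'm \<Rightarrow> 'n canonical) \<Rightarrow>
   'm \<Rightarrow> 'n multivector \<Rightarrow> 'n multivector" where
  "metric_hodge g e e' p X =
     inv (ext_alg (blinfun_apply (g p))) (reversion X) \<lrcorner> metric_volume g e e' p"

end

(* The Clifford product with the metric volume tau from the left, and the map X |-> g^-1(X) _| tau
   underlying the Hodge map, are both linear maps T with T 1 = tau and
   T (v /\ X) = +-(g^-1(v) _| T X).  Compatibility of gamma with g gives D^+ (g^-1 v) = g^-1 (D^- v)
   and D^- tau = 0 (the latter by differentiating the exterior extension of g on the top blade,
   where it is multiplication by det g), so the Leibniz rule for contractions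
   D^- (w _| Y) = (D^+ w) _| Y + w _| (D^- Y) shows, blade by blade, that T commutes with D^-.
   Both identities are then pointwise: T turns v /\ into a contraction with g^-1(v), and the Hodge
   map turns a contraction into v /\. *)

theory Submission
  imports Defs
begin

text \<open>The Clifford product is given only by axioms and uniqueness, for a metric that changes
  from point to point, so there is no explicit expression in \<open>g\<close> to differentiate. The
  rule T (v \<and> X) = \<epsilon> (g^-1(v) \<lrcorner> T X) takes its place: products of vectors
  span the algebra, so this rule and T 1 determine T, and the differentiability of T comes out
  together with its derivative. Both covariant derivatives occur because contraction is the adjoint
  of wedging: if the multivector is differentiated by D^-, the vector contracted into it has to be
  differentiated by D^+. The sign (-1)^(n+1) is the price of moving a vector through the
  pseudoscalar. The minus sign and the hat of the Hodge identity have another source: the Hodge map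
  contains a reversion, and reversing v \<lrcorner> X differs from contracting v into the reversed X
  by a grade involution.\<close>

lemma multivector_induct:
  fixes S :: "'n::{finite, linorder} multivector set"
  assumes "subspace S" "scalar 1 \<in> S" and cl: "\<And>i X. X \<in> S \<Longrightarrow> vec1 (\<b> i) \<and>\<^sub>e X \<in> S"
  shows "X \<in> S"
\<comment> \<open>With contraction vectors 0 and no involution, the generating operators reduce to
  wedging by basis vectors.\<close>
proof (rule multivector_generated[of S "\<lambda>X. X" "\<lambda>_. 1" "\<lambda>_. 0"])
  show "vec1 0 \<lrcorner> Y + vec1 (\<b> i) \<and>\<^sub>e Y \<in> S" if "Y \<in> S" for i Y
    using cl[OF that] by (simp add: linear_0[OF linear_lcontr_vec1])
qed (use assms in auto)

lemma linear_eq_on_generators: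
  fixes f h :: "'n::{finite, linorder} multivector \<Rightarrow> 'a::real_vector"
  assumes "linear f" "linear h" "f (scalar 1) = h (scalar 1)"
    and "\<And>i X. f X = h X \<Longrightarrow> f (vec1 (\<b> i) \<and>\<^sub>e X) = h (vec1 (\<b> i) \<and>\<^sub>e X)"
  shows "f X = h X"
proof -
  have "X \<in> {X. f X = h X}"
    by (rule multivector_induct)
      (use assms in \<open>auto simp: subspace_def linear_0 linear_add linear_scale\<close>)
  then show ?thesis by simp
qed

lemma vec1_wedge_swap: "vec1 v \<and>\<^sub>e (vec1 w \<and>\<^sub>e X) = - (vec1 w \<and>\<^sub>e (vec1 v \<and>\<^sub>e X))"
  by (simp add: wedge_assoc[symmetric] vec1_wedge_vec1[of v w] linear_neg[OF linear_wedge(1)])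

lemma vec1_wedge_self [simp]: "vec1 v \<and>\<^sub>e (vec1 v \<and>\<^sub>e X) = 0"
  using vec1_wedge_swap[of v v X] by (metis eq_neg_iff_add_eq_0 scaleR_2 scaleR_eq_0_iff zero_neq_numeral)

section \<open>The derivation extension of an endomorphism\<close>

text \<open>Contraction is an antiderivation; its sign is undone by moving \<open>t b_mu\<close>
  past \<open>v\<close>, and the terms carrying the coordinates of \<open>v\<close> reassemble
  \<open>t v\<close>. So \<open>conn_ext t\<close> is the derivation of the exterior algebra that
  extends \<open>t\<close>.\<close>

lemma conn_ext_wedge:
  assumes "linear t"
  shows "conn_ext t (vec1 v \<and>\<^sub>e X) = vec1 (t v) \<and>\<^sub>e X + vec1 v \<and>\<^sub>e conn_ext t X"
proof -
  have tv: "t v = (\<Sum>\<mu>\<in>UNIV. v $ \<mu> *\<^sub>R t (\<b> \<mu>))"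
    using basis_expansion[of v] linear_sum[OF assms, of "\<lambda>\<mu>. v $ \<mu> *\<^sub>R \<b> \<mu>" UNIV]
    by (simp add: scalar_mult_eq_scaleR linear_scale[OF assms])
  have "conn_ext t (vec1 v \<and>\<^sub>e X) =
      (\<Sum>\<mu>\<in>UNIV. (v $ \<mu>) *\<^sub>R (vec1 (t (\<b> \<mu>)) \<and>\<^sub>e X) + vec1 v \<and>\<^sub>e (vec1 (t (\<b> \<mu>)) \<and>\<^sub>e (vec1 (\<b> \<mu>) \<lrcorner> X)))"
    unfolding conn_ext_def
    by (simp add: contraction_wedge linear_diff[OF linear_wedge(2)] linear_scale[OF linear_wedge(2)]
        inner_axis' vec1_wedge_swap[of v])
  then show ?thesis
    by (simp add: tv conn_ext_def sum.distrib linear_sum[OF linear_vec1] linear_sum[OF linear_wedge(1)]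
        linear_scale[OF linear_vec1] linear_scale[OF linear_wedge(1)] linear_sum[OF linear_wedge(2)])
qed

lemma linear_conn_ext: "linear (conn_ext t)"
  by (rule linearI) (simp_all add: conn_ext_def linear_add[OF linear_lcontr] linear_add[OF linear_wedge(2)]
      linear_scale[OF linear_lcontr] linear_scale[OF linear_wedge(2)] sum.distrib scaleR_right.sum)

lemma conn_ext_scalar [simp]: "conn_ext t (scalar c) = 0"
  by (simp add: conn_ext_def lcontr_scalar linear_0[OF linear_wedge(2)])

text \<open>The Euclidean adjoint of \<open>conn_ext_wedge\<close>, contraction by \<open>w\<close>
  being adjoint to wedging by \<open>w\<close>. The minus sign on \<open>t w\<close> is what
  produces a Leibniz rule mixing D^+ on vectors with D^- on multivectors.\<close>

lemma conn_ext_adjoint_lcontr: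
  assumes "linear t"
  shows "adjoint (conn_ext t) (vec1 w \<lrcorner> X) =
    vec1 w \<lrcorner> adjoint (conn_ext t) X - vec1 (t w) \<lrcorner> X"
  by (rule inner_ext)
    (simp add: adjoint_clauses linear_conn_ext inner_lcontr conn_ext_wedge[OF assms] inner_diff_left inner_add_right)

text \<open>Wedging by \<open>b_nu\<close> after contracting by \<open>b_mu\<close> has as adjoint
  the same operator with the two indices exchanged, so taking the adjoint transposes the matrix of
  \<open>t\<close>. In particular the adjoint is again a derivation.\<close>

lemma adjoint_conn_ext:
  fixes t :: "'n::{finite, linorder} canonical \<Rightarrow> 'n canonical"
  assumes t: "linear t"
  shows "adjoint (conn_ext t) = conn_ext (adjoint t)"
proof (rule adjoint_unique, intro allI)
  fix X Y :: "'n multivector"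
  have ex: "v = (\<Sum>\<nu>\<in>UNIV. (v \<bullet> \<b> \<nu>) *\<^sub>R \<b> \<nu>)" for v :: "'n canonical"
    using basis_expansion[of v] by (simp add: scalar_mult_eq_scaleR inner_axis)
  have "vec1 (t (\<b> \<mu>)) \<and>\<^sub>e (vec1 (\<b> \<mu>) \<lrcorner> X) =
      (\<Sum>\<nu>\<in>UNIV. (t (\<b> \<mu>) \<bullet> \<b> \<nu>) *\<^sub>R (vec1 (\<b> \<nu>) \<and>\<^sub>e (vec1 (\<b> \<mu>) \<lrcorner> X)))" for \<mu>
    by (subst ex[of "t (\<b> \<mu>)"]) (simp add: linear_sum[OF linear_vec1] linear_sum[OF linear_wedge(1)]
        linear_scale[OF linear_vec1] linear_scale[OF linear_wedge(1)])
  then have "conn_ext t X \<bullet> Y = (\<Sum>\<mu>\<in>UNIV. \<Sum>\<nu>\<in>UNIV. (t (\<b> \<mu>) \<bullet> \<b> \<nu>) *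
      ((vec1 (\<b> \<nu>) \<and>\<^sub>e (vec1 (\<b> \<mu>) \<lrcorner> X)) \<bullet> Y))"
    by (simp add: conn_ext_def inner_sum_left)
  also have "\<dots> = (\<Sum>\<mu>\<in>UNIV. \<Sum>\<nu>\<in>UNIV. (adjoint t (\<b> \<nu>) \<bullet> \<b> \<mu>) *
      (X \<bullet> (vec1 (\<b> \<mu>) \<and>\<^sub>e (vec1 (\<b> \<nu>) \<lrcorner> Y))))"
  proof -
    have "(vec1 v \<and>\<^sub>e (vec1 w \<lrcorner> X)) \<bullet> Y = X \<bullet> (vec1 w \<and>\<^sub>e (vec1 v \<lrcorner> Y))" for v w
      by (metis inner_commute inner_lcontr reversion_vec1)
    then show ?thesis
      by (simp add: adjoint_clauses[OF t]) (simp add: inner_commute)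
  qed
  also have "\<dots> = X \<bullet> conn_ext (adjoint t) Y"
  proof -
    have "vec1 (adjoint t (\<b> \<nu>)) \<and>\<^sub>e (vec1 (\<b> \<nu>) \<lrcorner> Y) =
      (\<Sum>\<mu>\<in>UNIV. (adjoint t (\<b> \<nu>) \<bullet> \<b> \<mu>) *\<^sub>R (vec1 (\<b> \<mu>) \<and>\<^sub>e (vec1 (\<b> \<nu>) \<lrcorner> Y)))" for \<nu>
      by (subst ex[of "adjoint t (\<b> \<nu>)"]) (simp add: linear_sum[OF linear_vec1] linear_sum[OF linear_wedge(1)]
        linear_scale[OF linear_vec1] linear_scale[OF linear_wedge(1)])
    then show ?thesis
      by (subst sum.swap) (simp add: conn_ext_def inner_sum_right)
  qed
  finally show "conn_ext t X \<bullet> Y = X \<bullet> conn_ext (adjoint t) Y" .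
qed

text \<open>Treats the grade involution, the reversion and the projection onto a single grade at
  once: what matters about each is only that it is a scalar on every grade.\<close>

definition grade_scale :: "(nat \<Rightarrow> real) \<Rightarrow> 'n::finite multivector \<Rightarrow> 'n multivector" where
  "grade_scale \<sigma> X = (\<chi> A. \<sigma> (card A) * X $ A)"

lemma grade_scale_nth: "grade_scale \<sigma> X $ A = \<sigma> (card A) * X $ A"
  by (simp add: grade_scale_def)

lemma grade_inv_eq_grade_scale: "grade_inv = grade_scale (\<lambda>k. (- 1) ^ k)"
  by (simp add: fun_eq_iff grade_inv_def grade_scale_def)

lemma reversion_eq_grade_scale: "reversion = grade_scale (\<lambda>k. (- 1) ^ (k * (k - 1) div 2))"
  by (simp add: fun_eq_iff reversion_def grade_scale_def)

text \<open>\<open>conn_ext t\<close> preserves grades: each summand lowers the grade by one and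
  raises it again. In coefficients, the value at \<open>C\<close> reads \<open>X\<close> at
  \<open>C\<close> with \<open>i\<close> exchanged for \<open>j\<close>, a set of the same
  size.\<close>

lemma conn_ext_grade_scale: "conn_ext t (grade_scale \<sigma> X) = grade_scale \<sigma> (conn_ext t X)"
proof (rule multivector_eqI)
  fix C
  have *: "(axis {i} 1 \<and>\<^sub>e (axis {j} 1 \<lrcorner> grade_scale \<sigma> X)) $ C =
      \<sigma> (card C) * (axis {i} 1 \<and>\<^sub>e (axis {j} 1 \<lrcorner> X)) $ C" for i j
  proof (cases "i \<in> C \<and> j \<notin> C - {i}")
    case True
    then have "card (insert j (C - {i})) = card C"
      by (metis card.remove card_insert_disjoint finite finite_Diff)
    then show ?thesis using True
      unfolding basis_wedge_nth basis_lcontr_nth grade_scale_def vec_lambda_beta by auto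
  qed (auto simp: basis_wedge_nth basis_lcontr_nth)
  show "conn_ext t (grade_scale \<sigma> X) $ C = grade_scale \<sigma> (conn_ext t X) $ C"
    by (simp add: conn_ext_def vec1_basis vec1_expand[of "t _"] linear_sum[OF linear_wedge(1)]
        linear_scale[OF linear_wedge(1)] * grade_scale_nth sum_distrib_left sum_component ac_simps)
qed

lemma linear_grade_scale: "linear (grade_scale \<sigma>)"
  by (rule linearI) (auto simp: grade_scale_def vec_eq_iff algebra_simps)

lemma inner_grade_scale: "grade_scale \<sigma> X \<bullet> Y = X \<bullet> grade_scale \<sigma> Y"
  by (simp add: inner_vec_def grade_scale_def algebra_simps)

lemma adjoint_conn_ext_grade_scale:
  "adjoint (conn_ext t) (grade_scale \<sigma> X) = grade_scale \<sigma> (adjoint (conn_ext t) X)"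
  by (rule inner_ext)
    (simp add: adjoint_clauses linear_conn_ext inner_grade_scale conn_ext_grade_scale)

section \<open>Reversion against wedging and contraction\<close>

lemma reversion_reversion [simp]: "reversion (reversion X) = X"
  by (simp add: reversion_def vec_eq_iff flip: mult.assoc power_add mult_2)

lemma grade_inv_reversion_grade_inv [simp]: "grade_inv (reversion (grade_inv X)) = reversion X"
  by (simp add: grade_inv_def reversion_def vec_eq_iff ac_simps flip: mult.assoc)

text \<open>Reversing sends \<open>v\<close> to the far end; bringing it back past grade k costs
  (-1)^k. Numerically, (k+1)k/2 = k + k(k-1)/2.\<close>

lemma reversion_vec1_wedge: "reversion (vec1 v \<and>\<^sub>e X) = vec1 v \<and>\<^sub>e grade_inv (reversion X)"
proof -
  have *: "reversion (axis {i} 1 \<and>\<^sub>e X) = axis {i} 1 \<and>\<^sub>e grade_inv (reversion X)" for i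
  proof (rule multivector_eqI)
    fix C
    have "(- 1) ^ (card C * (card C - 1) div 2) =
        (- 1) ^ card (C - {i}) * (- 1 :: real) ^ (card (C - {i}) * (card (C - {i}) - 1) div 2)" if "i \<in> C"
    proof -
      obtain k where k: "card (C - {i}) = k" "card C = Suc k"
        using card_Suc_Diff1[OF finite \<open>i \<in> C\<close>] by metis
      have "Suc k * k div 2 = k + k * (k - 1) div 2"
        by (cases k) (auto simp: algebra_simps)
      then show ?thesis by (simp add: k power_add del: card_Diff_insert mult_Suc)
    qed
    then show "reversion (axis {i} 1 \<and>\<^sub>e X) $ C = (axis {i} 1 \<and>\<^sub>e grade_inv (reversion X)) $ C"
      by (cases "i \<in> C") (simp_all add: grade_inv_def reversion_def basis_wedge_nth del: card_Diff_insert)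
  qed
  show ?thesis
    by (simp add: vec1_expand linear_sum[OF linear_wedge(1)] linear_sum[OF linear_reversion]
        linear_scale[OF linear_reversion] linear_scale[OF linear_wedge(1)] *)
qed

lemma reversion_lcontr_vec1: "reversion (vec1 v \<lrcorner> X) = grade_inv (vec1 v \<lrcorner> reversion X)"
proof (rule inner_ext)
  fix Z
  have "reversion (vec1 v \<lrcorner> X) \<bullet> Z = X \<bullet> (vec1 v \<and>\<^sub>e reversion Z)"
    by (simp add: reversion_eq_grade_scale inner_grade_scale)
      (simp add: inner_lcontr flip: reversion_eq_grade_scale)
  also have "\<dots> = X \<bullet> reversion (vec1 v \<and>\<^sub>e grade_inv Z)"
    by (simp add: reversion_vec1_wedge)
  also have "\<dots> = grade_inv (vec1 v \<lrcorner> reversion X) \<bullet> Z"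
    by (simp add: inner_grade_inv inner_lcontr)
      (simp add: reversion_eq_grade_scale inner_grade_scale)
  finally show "reversion (vec1 v \<lrcorner> X) \<bullet> Z = grade_inv (vec1 v \<lrcorner> reversion X) \<bullet> Z" .
qed

section \<open>The exterior extension of an endomorphism\<close>

lemma linear_ext_alg: "linear (ext_alg t)"
  by (rule linearI) (simp_all add: ext_alg_def sum.distrib algebra_simps scaleR_right.sum)

lemma ext_alg_axis: "ext_alg t (axis A 1) = wedge_list (map (\<lambda>i. t (\<b> i)) (sorted_list_of_set A))"
proof -
  have "ext_alg t (axis A 1) =
      (\<Sum>B\<in>UNIV. if B = A then wedge_list (map (\<lambda>i. t (\<b> i)) (sorted_list_of_set A)) else 0)"
    unfolding ext_alg_def by (rule sum.cong) (auto simp: axis_def)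
  then show ?thesis by simp
qed

lemma ext_alg_scalar [simp]: "ext_alg t (scalar 1) = scalar 1"
  unfolding scalar_def ext_alg_axis by (simp add: scalar_def)

text \<open>\<open>ext_alg\<close> is defined on sorted blades, so the work is to insert an index
  into a sorted list. By induction on the list, the new index is prepended, or repeats the head
  (both sides vanish), or is moved past the head at the cost of a sign.\<close>

lemma ext_alg_wedge:
  fixes t :: "'n::{finite, linorder} canonical \<Rightarrow> 'n canonical"
  assumes t: "linear t"
  shows "ext_alg t (vec1 v \<and>\<^sub>e X) = vec1 (t v) \<and>\<^sub>e ext_alg t X"
proof -
  have less: "vec1 (t (\<b> i)) \<and>\<^sub>e ext_alg t (axis B 1) = ext_alg t (axis {i} 1 \<and>\<^sub>e axis B 1)"
    if "\<forall>j\<in>B. i < j" for i B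
  proof -
    have "{c \<in> B. c < i} = {}" "i \<notin> B" using that by auto
    moreover have "sorted_list_of_set (insert i B) = i # sorted_list_of_set B"
      using that \<open>i \<notin> B\<close> by (auto intro!: insort_is_Cons less_imp_le)
    ultimately show ?thesis
      by (simp add: basis_wedge_axis ext_alg_axis wedge_list_Cons del: Collect_empty_eq)
  qed
  have basis: "vec1 (t (\<b> i)) \<and>\<^sub>e ext_alg t (axis (set xs) 1) = ext_alg t (axis {i} 1 \<and>\<^sub>e axis (set xs) 1)"
    if "sorted xs" "distinct xs" for i xs
    using that
  proof (induction xs)
    case Nil
    then show ?case by (simp add: less)
  next
    case (Cons x ys)
    have x: "\<forall>j\<in>set ys. x < j" using Cons.prems by (auto simp: less_le)
    have e: "axis (set (x # ys)) 1 = axis {x} (1::real) \<and>\<^sub>e axis (set ys) 1"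
    proof -
      have "{c \<in> set ys. c < x} = {}" "x \<notin> set ys" using x by auto
      then show ?thesis by (simp add: basis_wedge_axis del: Collect_empty_eq)
    qed
    have E: "ext_alg t (axis (set (x # ys)) 1) = vec1 (t (\<b> x)) \<and>\<^sub>e ext_alg t (axis (set ys) 1)"
      unfolding e by (rule less[OF x, symmetric])
    consider "i < x" | "i = x" | "x < i" by (rule linorder_cases)
    then show ?case
    proof cases
      case 1
      then show ?thesis by (intro less) (use x in auto)
    next
      case 2
      have "axis {x} (1::real) \<and>\<^sub>e (axis {x} 1 \<and>\<^sub>e axis (set ys) 1) = 0"
        using vec1_wedge_self[of "\<b> x"] by (simp add: vec1_basis)
      then show ?thesis unfolding E 2 unfolding e by (simp add: linear_0[OF linear_ext_alg])
    next
      case 3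
      \<comment> \<open>Swap past the head \<open>x\<close> and apply the induction hypothesis to
        the tail. As \<open>x\<close> lies below \<open>i\<close> and below the tail,
        \<open>less\<close> then puts it back in front.\<close>
      have "vec1 (t (\<b> i)) \<and>\<^sub>e ext_alg t (axis (set (x # ys)) 1) =
          - (vec1 (t (\<b> x)) \<and>\<^sub>e ext_alg t (axis {i} 1 \<and>\<^sub>e axis (set ys) 1))"
        unfolding E using Cons.IH Cons.prems by (simp add: vec1_wedge_swap[of "t (\<b> i)"])
      also have "vec1 (t (\<b> x)) \<and>\<^sub>e ext_alg t (axis {i} 1 \<and>\<^sub>e axis (set ys) 1) =
          ext_alg t (axis {x} 1 \<and>\<^sub>e (axis {i} 1 \<and>\<^sub>e axis (set ys) 1))"
        using less[of "insert i (set ys)" x] 3 x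
        by (simp add: basis_wedge_axis[of i] linear_scale[OF linear_ext_alg] linear_scale[OF linear_wedge(2)]
            linear_0[OF linear_ext_alg] linear_0[OF linear_wedge(2)])
      also have "\<dots> = - ext_alg t (axis {i} 1 \<and>\<^sub>e axis (set (x # ys)) 1)"
        unfolding e using vec1_wedge_swap[of "\<b> x" "\<b> i"]
        by (simp add: vec1_basis linear_neg[OF linear_ext_alg])
      finally show ?thesis by simp
    qed
  qed
  have "vec1 (t (\<b> i)) \<and>\<^sub>e ext_alg t X = ext_alg t (vec1 (\<b> i) \<and>\<^sub>e X)" for i
  proof -
    have *: "vec1 (t (\<b> i)) \<and>\<^sub>e ext_alg t (axis A 1) = ext_alg t (vec1 (\<b> i) \<and>\<^sub>e axis A 1)" for A
      using basis[of "sorted_list_of_set A"] by (simp add: vec1_basis)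
    show ?thesis
      by (subst (1 2) multivector_expand[of X])
        (simp add: linear_sum[OF linear_ext_alg] linear_sum[OF linear_wedge(2)]
          linear_scale[OF linear_ext_alg] linear_scale[OF linear_wedge(2)] *)
  qed
  note bv = this
  have v: "v = (\<Sum>i\<in>UNIV. v $ i *\<^sub>R \<b> i)"
    using basis_expansion[of v] by (simp add: scalar_mult_eq_scaleR)
  show ?thesis
    by (subst (1 2) v) (simp add: linear_sum[OF linear_vec1] linear_sum[OF linear_wedge(1)] linear_sum[OF t]
        linear_sum[OF linear_ext_alg] linear_scale[OF linear_vec1] linear_scale[OF linear_wedge(1)]
        linear_scale[OF t] linear_scale[OF linear_ext_alg] bv)
qed

lemma ext_alg_compose:
  assumes "linear s" "linear t"
  shows "ext_alg s (ext_alg t X) = ext_alg (s \<circ> t) X"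
  by (rule linear_eq_on_generators[of "\<lambda>X. ext_alg s (ext_alg t X)"])
    (use linear_compose[OF linear_ext_alg linear_ext_alg, of s t] in
      \<open>simp_all add: o_def linear_ext_alg ext_alg_wedge assms linear_compose[OF assms(2,1), unfolded o_def]\<close>)

lemma ext_alg_id: "ext_alg id X = X"
  by (simp add: ext_alg_def wedge_list_basis flip: multivector_expand)

text \<open>By functoriality. The Hodge map uses the inverse of the extension; this rewrites it as
  an extension, to which \<open>ext_alg_wedge\<close> applies.\<close>

lemma inv_ext_alg:
  assumes t: "linear t" "bij t"
  shows "inv (ext_alg t) = ext_alg (inv t)"
proof -
  have it: "linear (inv t)"
    using inj_linear_imp_inv_linear[of t] t by (simp add: bij_is_inj)
  show ?thesis
  proof (rule inv_unique_comp)
    have "t \<circ> inv t = id" "inv t \<circ> t = id"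
      using t(2) by (auto simp: bij_is_inj bij_is_surj surj_iff[symmetric] inj_iff[symmetric])
    then show "ext_alg t \<circ> ext_alg (inv t) = id" "ext_alg (inv t) \<circ> ext_alg t = id"
      by (auto intro!: ext simp: ext_alg_compose t it ext_alg_id)
  qed
qed

section \<open>Pseudoscalars\<close>

lemma wedge_list_top:
  fixes vs :: "'n::{finite, linorder} canonical list"
  assumes "length vs = CARD('n)"
  shows "wedge_list vs = (wedge_list vs $ UNIV) *\<^sub>R axis UNIV 1"
proof (rule multivector_eqI)
  fix A :: "'n set"
  have "wedge_list vs $ A = 0" if "A \<noteq> UNIV"
    using wedge_list_grade[of vs A] assms that card_subset_eq[of UNIV A] by auto
  then show "wedge_list vs $ A = ((wedge_list vs $ UNIV) *\<^sub>R axis UNIV 1) $ A"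
    by (auto simp: axis_def)
qed

lemma wedge_all_top:
  fixes v :: "'n::{finite, linorder} \<Rightarrow> 'n canonical"
  shows "wedge_all v = (wedge_all v $ UNIV) *\<^sub>R axis UNIV 1"
  unfolding wedge_all_def by (rule wedge_list_top) simp

text \<open>\<open>inner_wedge_list\<close> sums over permutations of an initial segment of the
  naturals, \<open>det\<close> over permutations of the index type. Conjugation by the increasing
  enumeration \<open>f\<close> matches the two sums and preserves signs.\<close>

lemma inner_wedge_all:
  fixes v w :: "'n::{finite, linorder} \<Rightarrow> 'n canonical"
  shows "wedge_all v \<bullet> wedge_all w = det (\<chi> i j. v i \<bullet> w j)"
proof -
  define n where "n = CARD('n)"
  define f where "f i = sorted_list_of_set (UNIV :: 'n set) ! i" for i
  have f: "bij_betw f {..<n} UNIV"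
    unfolding f_def n_def by (rule bij_betw_nth) auto
  have wf: "wedge_all u = wedge_list (map (u \<circ> f) [0..<n])" for u :: "'n \<Rightarrow> 'n canonical"
    unfolding wedge_all_def n_def by (rule arg_cong[of _ _ wedge_list]) (auto simp: list_eq_iff_nth_eq f_def)
  have "wedge_all v \<bullet> wedge_all w =
      (\<Sum>p | p permutes {..<n}. of_int (sign p) * (\<Prod>i<n. v (f i) \<bullet> w (f (p i))))"
    by (simp add: wf inner_wedge_list del: map_map)
  also have "\<dots> = (\<Sum>q | q permutes (UNIV :: 'n set). of_int (sign q) * (\<Prod>i\<in>UNIV. v i \<bullet> w (q i)))"
  proof (rule sum.reindex_bij_witness[where i = "map_permutation UNIV (inv_into {..<n} f)"
        and j = "map_permutation {..<n} f"], goal_cases)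
    case (1 p)
    then show ?case
      by (intro map_permutation_compose_inv[OF f]) (use f in \<open>auto simp: bij_betw_inv_into_left\<close>)
  next
    case (2 p)
    then show ?case
      using map_permutation_permutes[OF f] by auto
  next
    case (3 q)
    then show ?case
      by (intro map_permutation_compose_inv[OF bij_betw_inv_into[OF f]])
        (use f in \<open>auto simp: bij_betw_inv_into_right\<close>)
  next
    case (4 q)
    then show ?case
      using map_permutation_permutes[OF bij_betw_inv_into[OF f]] by auto
  next
    case (5 p)
    have inj: "inj_on f {..<n}" using f by (simp add: bij_betw_def)
    have "(\<Prod>i\<in>UNIV. v i \<bullet> w (map_permutation {..<n} f p i)) =
        (\<Prod>i<n. v (f i) \<bullet> w (map_permutation {..<n} f p (f i)))"
      by (rule prod.reindex_bij_betw[OF f, symmetric])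
    then show ?case
      using 5 by (simp add: sign_map_permutation[OF inj] map_permutation_apply[OF inj])
  qed
  finally show ?thesis by (simp add: det_def)
qed

lemma wedge_all_basis: "wedge_all \<b> = axis UNIV 1"
  unfolding wedge_all_def by (rule wedge_list_basis)

lemma ext_alg_pseudoscalar:
  fixes t :: "'n::{finite, linorder} canonical \<Rightarrow> 'n canonical"
  shows "ext_alg t (axis UNIV 1) = det (matrix t) *\<^sub>R axis UNIV 1"
proof -
  have e: "ext_alg t (axis UNIV 1) = wedge_all (\<lambda>i. t (\<b> i))"
    by (simp add: ext_alg_axis wedge_all_def)
  have "wedge_all (\<lambda>i. t (\<b> i)) $ UNIV = wedge_all (\<lambda>i. t (\<b> i)) \<bullet> wedge_all \<b>"
    by (simp add: wedge_all_basis inner_axis)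
  also have "\<dots> = det (transpose (matrix t))"
    by (simp add: inner_wedge_all inner_axis matrix_def transpose_def)
  finally show ?thesis
    unfolding e by (subst wedge_all_top) (simp add: det_transpose)
qed

text \<open>The Gram determinant of biorthogonal frames is 1, so the top coefficients satisfy
  \<open>E * E' = 1\<close>, whence |E| E' = sgn E'. Only the orientation of the frame survives in
  the volume.\<close>

lemma volume_eq_sgn:
  fixes e e' :: "'n::{finite, linorder} \<Rightarrow> 'm \<Rightarrow> 'n canonical"
  assumes "\<And>\<mu> \<nu>. e \<mu> p \<bullet> e' \<nu> p = (if \<mu> = \<nu> then 1 else 0)"
  shows "wedge_all (\<lambda>\<mu>. e' \<mu> p) $ UNIV \<noteq> 0"
    and "volume e e' p = sgn (wedge_all (\<lambda>\<mu>. e' \<mu> p) $ UNIV) *\<^sub>R axis UNIV 1"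
proof -
  define E E' where "E = wedge_all (\<lambda>\<mu>. e \<mu> p) $ UNIV" and "E' = wedge_all (\<lambda>\<mu>. e' \<mu> p) $ UNIV"
  have EE: "wedge_all (\<lambda>\<mu>. e \<mu> p) = E *\<^sub>R axis UNIV 1" "wedge_all (\<lambda>\<mu>. e' \<mu> p) = E' *\<^sub>R axis UNIV 1"
    unfolding E_def E'_def by (rule wedge_all_top)+
  have "E * E' = wedge_all (\<lambda>\<mu>. e \<mu> p) \<bullet> wedge_all (\<lambda>\<mu>. e' \<mu> p)"
    by (simp add: EE inner_axis_axis)
  also have "\<dots> = det (mat 1 :: ((real, 'n) vec, 'n) vec)"
    unfolding inner_wedge_all by (simp add: assms mat_def)
  finally have "E * E' = 1" by simp
  then have "E' \<noteq> 0" by auto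
  have "\<bar>E\<bar> * \<bar>E'\<bar> = 1"
    using \<open>E * E' = 1\<close> by (simp flip: abs_mult)
  then have "\<bar>E\<bar> * E' = sgn E'"
    by (metis mult.left_commute mult.right_neutral sgn_mult_abs)
  with \<open>E' \<noteq> 0\<close> show "wedge_all (\<lambda>\<mu>. e' \<mu> p) $ UNIV \<noteq> 0"
    and "volume e e' p = sgn (wedge_all (\<lambda>\<mu>. e' \<mu> p) $ UNIV) *\<^sub>R axis UNIV 1"
    unfolding volume_def EE by (simp_all add: inner_axis_axis E_def[symmetric] E'_def[symmetric] flip: power2_eq_square)
qed

lemma conn_ext_pseudoscalar:
  fixes t :: "'n::{finite, linorder} canonical \<Rightarrow> 'n canonical"
  shows "conn_ext t (axis UNIV 1) = (conn_ext t (axis UNIV 1) $ UNIV) *\<^sub>R axis UNIV 1"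
proof (rule multivector_eqI)
  fix A :: "'n set"
  \<comment> \<open>The indicator of the top grade: \<open>grade_scale\<close> by it projects onto
    the line of pseudoscalars.\<close>
  define \<sigma> where "\<sigma> k = (if k = CARD('n) then 1 else 0 :: real)" for k
  have full: "card B = CARD('n) \<longleftrightarrow> B = UNIV" for B :: "'n set"
    using card_subset_eq[of UNIV B] by auto
  have "grade_scale \<sigma> (axis UNIV 1) = (axis UNIV 1 :: 'n multivector)"
    by (auto simp: grade_scale_def \<sigma>_def vec_eq_iff axis_def full)
  then have "conn_ext t (axis UNIV 1) $ A = grade_scale \<sigma> (conn_ext t (axis UNIV 1)) $ A"
    by (metis conn_ext_grade_scale)
  also have "\<dots> = 0" if "A \<noteq> UNIV"
    using that by (simp add: grade_scale_nth \<sigma>_def full)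
  finally show "conn_ext t (axis UNIV 1) $ A = ((conn_ext t (axis UNIV 1) $ UNIV) *\<^sub>R axis UNIV 1) $ A"
    by (auto simp: axis_def)
qed

text \<open>An operator and its adjoint that both preserve a line have the same eigenvalue on it.
  This shared number is the trace of \<open>t\<close>, but only the equality of the two is
  used.\<close>

lemma adjoint_conn_ext_pseudoscalar:
  assumes "linear t"
  shows "adjoint (conn_ext t) (axis UNIV 1) = (conn_ext t (axis UNIV 1) $ UNIV) *\<^sub>R axis UNIV 1"
proof -
  have "adjoint (conn_ext t) (axis UNIV 1) $ UNIV = axis UNIV 1 \<bullet> adjoint (conn_ext t) (axis UNIV 1)"
    by (simp add: inner_axis')
  also have "\<dots> = conn_ext t (axis UNIV 1) $ UNIV"
    by (simp add: adjoint_clauses linear_conn_ext inner_axis)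
  finally show ?thesis
    using conn_ext_pseudoscalar[of "adjoint t"] by (simp add: adjoint_conn_ext[OF assms])
qed

section \<open>Contraction of multivectors and the top blade\<close>

lemma wedge_pseudoscalar: "vec1 v \<and>\<^sub>e axis UNIV 1 = 0"
  by (simp add: vec1_expand linear_sum[OF linear_wedge(1)] linear_scale[OF linear_wedge(1)] basis_wedge_axis)

text \<open>Reversion puts \<open>v\<close> last in the first factor, hence next to the test
  multivector. This is what makes contraction into a fixed multivector one of the maps T, with sign
  +1.\<close>

lemma lcontr_wedge: "(vec1 v \<and>\<^sub>e X) \<lrcorner> Y = vec1 v \<lrcorner> (X \<lrcorner> Y)"
  by (rule inner_ext)
    (simp add: inner_lcontr reversion_vec1_wedge wedge_vec1[symmetric] wedge_assoc)

lemma linear_lcontr_left: "linear (\<lambda>X. X \<lrcorner> Y)"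
  by (rule linearI; rule inner_ext) (simp_all add: inner_lcontr inner_add_left inner_add_right
      linear_add[OF linear_reversion] linear_scale[OF linear_reversion]
      linear_add[OF linear_wedge(1)] linear_scale[OF linear_wedge(1)])

lemma scalar_lcontr:
  fixes Y :: "'n::{finite, linorder} multivector"
  shows "scalar 1 \<lrcorner> Y = Y"
proof (rule inner_ext)
  have "reversion (scalar 1) = (scalar 1 :: 'n multivector)"
    by (auto simp: reversion_def scalar_def vec_eq_iff axis_def)
  then show "(scalar 1 \<lrcorner> Y) \<bullet> Z = Y \<bullet> Z" for Z
    by (simp add: inner_lcontr wedge_scalar)
qed

text \<open>Pairing with the blade of the complement \<open>- A\<close> isolates the coefficient of
  \<open>X\<close> at \<open>A\<close>, up to sign.\<close>

lemma lcontr_pseudoscalar_eq_0_iff: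
  "X \<lrcorner> axis UNIV 1 = 0 \<longleftrightarrow> X = 0"
proof
  assume 0: "X \<lrcorner> axis UNIV 1 = 0"
  show "X = 0"
  proof (rule multivector_eqI)
    fix A
    have "(X \<lrcorner> axis UNIV 1) \<bullet> axis (- A) 1 = (reversion X \<and>\<^sub>e axis (- A) 1) $ UNIV"
      by (simp add: inner_lcontr inner_axis')
    also have "\<dots> = (\<Sum>B\<in>UNIV. if B = A then shuffle_sign A (- A) * reversion X $ A else 0)"
      unfolding wedge_def vec_lambda_beta
      by (rule sum.cong) (auto simp: axis_def Compl_eq_Diff_UNIV[symmetric])
    finally have "shuffle_sign A (- A) * reversion X $ A = 0"
      by (simp add: 0)
    then show "X $ A = 0 $ A"
      by (simp add: shuffle_sign_def reversion_def)
  qed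
qed (simp add: linear_0[OF linear_lcontr_left])

lemma inverse_selfadjoint:
  fixes g :: "'n::{finite, linorder} canonical \<Rightarrow> 'n canonical"
  assumes "linear g" "adjoint g = g" "det (matrix g) \<noteq> 0"
  shows "bij g" and "linear (inv g)" and "inv g v \<bullet> w = v \<bullet> inv g w"
proof -
  show "bij g"
    using assms det_nz_iff_inj[of g] linear_injective_imp_surjective[of g] by (simp add: bij_def)
  then show "linear (inv g)"
    using inj_linear_imp_inv_linear[of g] assms by (simp add: bij_is_inj)
  have "g x \<bullet> y = x \<bullet> g y" for x y
    using adjoint_clauses(2)[OF assms(1), of x y] by (simp add: assms(2))
  then show "inv g v \<bullet> w = v \<bullet> inv g w"
    using \<open>bij g\<close> by (metis bij_inv_eq_iff)
qed

section \<open>Clifford multiplication by a pseudoscalar\<close>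

lemma is_clifford_product_clifford:
  assumes "linear h" "\<And>v w. h v \<bullet> w = v \<bullet> h w"
  shows "is_clifford_product h (clifford h)"
  unfolding clifford_def by (rule theI'[OF ex1_clifford_product]) fact+

text \<open>Conjugating the product by the grade involution replaces \<open>v\<close> by -v in both
  factors, which leaves the defining axioms for \<open>h\<close> intact; by uniqueness the
  conjugated product is the original one.\<close>

lemma grade_inv_clifford:
  fixes h :: "'n::{finite, linorder} canonical \<Rightarrow> 'n canonical"
  assumes h: "linear h" "\<And>v w. h v \<bullet> w = v \<bullet> h w"
  shows "grade_inv (clifford h X Y) = clifford h (grade_inv X) (grade_inv Y)"
proof -
  define Q where "Q X Y = grade_inv (clifford h (grade_inv X) (grade_inv Y))" for X Y
  have C: "is_clifford_product h (clifford h)"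
    using h by (rule is_clifford_product_clifford)
  then have bil: "bilinear (clifford h)"
    by (simp add: is_clifford_product_def)
  have neg: "grade_inv (vec1 v) = - vec1 v" for v :: "'n canonical"
    using grade_inv_vec1_wedge[of v "scalar 1"] by (simp add: wedge_scalar)
  have "is_clifford_product h Q"
    unfolding is_clifford_product_def
  proof (intro conjI allI)
    show "bilinear Q"
      unfolding bilinear_def Q_def
      by (auto intro!: linearI simp: linear_add[OF linear_grade_inv] linear_scale[OF linear_grade_inv]
          bilinear_ladd[OF bil] bilinear_radd[OF bil] bilinear_lmul[OF bil] bilinear_rmul[OF bil])
    show "Q (Q X Y) Z = Q X (Q Y Z)" for X Y Z
      using C by (simp add: Q_def is_clifford_product_def)
    show "Q (scalar c) X = c *\<^sub>R X" "Q X (scalar c) = c *\<^sub>R X" for c X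
      using C by (simp_all add: Q_def is_clifford_product_def linear_scale[OF linear_grade_inv])
    show "Q (vec1 v) X = vec1 (h v) \<lrcorner> X + vec1 v \<and>\<^sub>e X" for v X
      using C by (simp add: Q_def is_clifford_product_def neg bilinear_lneg[OF bil] linear_neg[OF linear_grade_inv]
          linear_add[OF linear_grade_inv] linear_diff[OF linear_grade_inv] grade_inv_lcontr grade_inv_vec1_wedge)
    show "Q X (vec1 v) = X \<llcorner> vec1 (h v) + X \<and>\<^sub>e vec1 v" for v X
      using C by (simp add: Q_def is_clifford_product_def neg bilinear_rneg[OF bil] linear_neg[OF linear_grade_inv]
          linear_add[OF linear_grade_inv] linear_diff[OF linear_grade_inv] grade_inv_lcontr grade_inv_vec1_wedge rcontr_vec1 wedge_vec1)
  qed
  with C have "Q = clifford h"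
    using ex1_clifford_product[OF h] by blast
  then have "clifford h (grade_inv X) (grade_inv Y) = Q (grade_inv X) (grade_inv Y)"
    by simp
  then show ?thesis by (simp add: Q_def)
qed

text \<open>Writing \<open>v\<^sup>\<sharp>\<close> for \<open>h v\<close>, the two mixed products are
  \<open>2 (v\<^sup>\<sharp> \<lrcorner> Z) = v \<diamond> Z - Z' \<diamond> v\<close> and \<open>2 (v \<and> Z) = v \<diamond> Z + Z' \<diamond> v\<close>, where \<open>Z'\<close>
  is the grade involution of \<open>Z\<close>, and a pseudoscalar commutes with vectors up to \<open>(-1)\<^bsup>n+1\<^esup>\<close>.\<close>
lemma lcontr_clifford_pseudoscalar:
  fixes h :: "'n::{finite, linorder} canonical \<Rightarrow> 'n canonical"
  assumes h: "linear h" "\<And>v w. h v \<bullet> w = v \<bullet> h w"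
    and \<tau>: "\<tau> = c *\<^sub>R axis UNIV 1"
  shows "vec1 (h v) \<lrcorner> clifford h \<tau> Y = (- 1) ^ (CARD('n) + 1) *\<^sub>R clifford h \<tau> (vec1 v \<and>\<^sub>e Y)"
proof -
  have C: "is_clifford_product h (clifford h)"
    using h by (rule is_clifford_product_clifford)
  then have bil: "bilinear (clifford h)"
    and assoc: "clifford h (clifford h X Y) Z = clifford h X (clifford h Y Z)"
    and left: "clifford h (vec1 v) X = vec1 (h v) \<lrcorner> X + vec1 v \<and>\<^sub>e X"
    and right: "clifford h (grade_inv X) (vec1 v) = - (vec1 (h v) \<lrcorner> X) + vec1 v \<and>\<^sub>e X"
    for X Y Z v
    by (simp_all add: is_clifford_product_def rcontr_vec1 grade_inv_lcontr wedge_vec1)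
  define s :: real where "s = (- 1) ^ CARD('n)"
  have ss: "s * s = 1" by (simp add: s_def flip: power_mult_distrib)
  have inv\<tau>: "grade_inv \<tau> = s *\<^sub>R \<tau>"
    by (simp add: \<tau> s_def grade_inv_axis linear_scale[OF linear_grade_inv])
  have w\<tau>: "vec1 v \<and>\<^sub>e \<tau> = 0"
    by (simp add: \<tau> linear_scale[OF linear_wedge(2)] wedge_pseudoscalar)
  \<comment> \<open>Since \<open>v\<close> wedged with \<open>\<tau>\<close> vanishes, both products
    of \<open>v\<close> with \<open>\<tau>\<close> consist of the contraction alone and differ only
    by sign and grade involution.\<close>
  have comm: "clifford h (vec1 v) \<tau> = - s *\<^sub>R clifford h \<tau> (vec1 v)"
  proof -
    have "clifford h \<tau> (vec1 v) = s *\<^sub>R clifford h (grade_inv \<tau>) (vec1 v)"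
      by (simp add: inv\<tau> bilinear_lmul[OF bil] ss)
    then show ?thesis
      by (simp add: right left w\<tau> ss)
  qed
  define Z where "Z = clifford h \<tau> Y"
  have gZ: "grade_inv Z = s *\<^sub>R clifford h \<tau> (grade_inv Y)"
    by (simp add: Z_def grade_inv_clifford[OF h] inv\<tau> bilinear_lmul[OF bil])
  have "2 *\<^sub>R (vec1 (h v) \<lrcorner> Z) = clifford h (vec1 v) Z - clifford h (grade_inv Z) (vec1 v)"
    by (simp add: left right scaleR_2)
  also have "\<dots> = - s *\<^sub>R clifford h \<tau> (clifford h (vec1 v) Y) - s *\<^sub>R clifford h \<tau> (clifford h (grade_inv Y) (vec1 v))"
    unfolding gZ by (simp add: Z_def assoc[symmetric] comm bilinear_lmul[OF bil] bilinear_lneg[OF bil])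
  also have "\<dots> = - s *\<^sub>R clifford h \<tau> (2 *\<^sub>R (vec1 v \<and>\<^sub>e Y))"
  proof -
    have "2 *\<^sub>R (vec1 v \<and>\<^sub>e Y) = clifford h (vec1 v) Y + clifford h (grade_inv Y) (vec1 v)"
      by (simp add: left right scaleR_2)
    then show ?thesis by (simp add: bilinear_radd[OF bil] scaleR_add_right)
  qed
  also have "\<dots> = 2 *\<^sub>R (- s *\<^sub>R clifford h \<tau> (vec1 v \<and>\<^sub>e Y))"
    by (simp add: bilinear_rmul[OF bil])
  finally have "vec1 (h v) \<lrcorner> Z = - s *\<^sub>R clifford h \<tau> (vec1 v \<and>\<^sub>e Y)"
    unfolding scaleR_cancel_left by simp
  then show ?thesis
    unfolding Z_def by (simp add: s_def)
qed

section \<open>Contracting a pseudoscalar\<close>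

text \<open>Induction on \<open>X\<close>: for scalars both sides vanish because
  \<open>\<tau>\<close> has top grade, and in the inductive step both sides are expanded by
  \<open>contraction_wedge\<close>. Self-adjointness of \<open>h\<close> identifies the two scalar
  terms.\<close>

lemma wedge_lcontr_pseudoscalar:
  fixes h :: "'n::{finite, linorder} canonical \<Rightarrow> 'n canonical"
  assumes h: "linear h" "\<And>v w. h v \<bullet> w = v \<bullet> h w"
    and \<tau>: "\<tau> = c *\<^sub>R axis UNIV 1"
  shows "vec1 v \<and>\<^sub>e (ext_alg h X \<lrcorner> \<tau>) = ext_alg h (vec1 (h v) \<lrcorner> X) \<lrcorner> \<tau>"
proof (rule linear_eq_on_generators[of "\<lambda>X. vec1 v \<and>\<^sub>e (ext_alg h X \<lrcorner> \<tau>)"])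
  show "linear (\<lambda>X. vec1 v \<and>\<^sub>e (ext_alg h X \<lrcorner> \<tau>))"
    using linear_compose[OF linear_compose[OF linear_ext_alg linear_lcontr_left] linear_wedge(2)]
    by (simp add: o_def)
  show "linear (\<lambda>X. ext_alg h (vec1 (h v) \<lrcorner> X) \<lrcorner> \<tau>)"
    using linear_compose[OF linear_compose[OF linear_lcontr linear_ext_alg] linear_lcontr_left]
    by (simp add: o_def)
  show "vec1 v \<and>\<^sub>e (ext_alg h (scalar 1) \<lrcorner> \<tau>) = ext_alg h (vec1 (h v) \<lrcorner> scalar 1) \<lrcorner> \<tau>"
    by (simp add: scalar_lcontr lcontr_scalar linear_0[OF linear_ext_alg] linear_0[OF linear_lcontr_left]
        \<tau> linear_scale[OF linear_wedge(2)] wedge_pseudoscalar)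
  show "vec1 v \<and>\<^sub>e (ext_alg h (vec1 (\<b> i) \<and>\<^sub>e X) \<lrcorner> \<tau>) = ext_alg h (vec1 (h v) \<lrcorner> (vec1 (\<b> i) \<and>\<^sub>e X)) \<lrcorner> \<tau>"
    if IH: "vec1 v \<and>\<^sub>e (ext_alg h X \<lrcorner> \<tau>) = ext_alg h (vec1 (h v) \<lrcorner> X) \<lrcorner> \<tau>" for i X
  proof -
    have "ext_alg h (vec1 (h v) \<lrcorner> (vec1 (\<b> i) \<and>\<^sub>e X)) \<lrcorner> \<tau> =
        (h v \<bullet> \<b> i) *\<^sub>R (ext_alg h X \<lrcorner> \<tau>) - vec1 (h (\<b> i)) \<lrcorner> (vec1 v \<and>\<^sub>e (ext_alg h X \<lrcorner> \<tau>))"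
      by (simp add: contraction_wedge linear_diff[OF linear_ext_alg] linear_scale[OF linear_ext_alg]
          linear_diff[OF linear_lcontr_left] linear_scale[OF linear_lcontr_left] ext_alg_wedge[OF h(1)]
          lcontr_wedge IH)
    also have "\<dots> = vec1 v \<and>\<^sub>e (vec1 (h (\<b> i)) \<lrcorner> (ext_alg h X \<lrcorner> \<tau>))"
      by (simp add: contraction_wedge h(2) inner_commute[of v])
    finally show ?thesis
      by (simp add: ext_alg_wedge[OF h(1)] lcontr_wedge)
  qed
qed

section \<open>Differentiating families of endomorphisms\<close>

lemma bounded_bilinear_vec1_wedge: "bounded_bilinear (\<lambda>v X. vec1 v \<and>\<^sub>e X)"
  unfolding bilinear_conv_bounded_bilinear[symmetric] bilinear_def
  using linear_compose[OF linear_vec1 linear_wedge(1)] linear_wedge(2) by (auto simp: o_def)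

lemma bounded_bilinear_vec1_lcontr: "bounded_bilinear (\<lambda>v X. vec1 v \<lrcorner> X)"
  unfolding bilinear_conv_bounded_bilinear[symmetric] bilinear_def
  using linear_lcontr_vec1 linear_lcontr by auto

lemma linear_basis_expand:
  fixes T :: "real ^ 'k \<Rightarrow> 'b::real_vector"
  assumes "linear T"
  shows "T v = (\<Sum>k\<in>UNIV. v $ k *\<^sub>R T (axis k 1))"
proof -
  have "T (\<Sum>k\<in>UNIV. v $ k *\<^sub>R axis k 1) = (\<Sum>k\<in>UNIV. v $ k *\<^sub>R T (axis k 1))"
    by (simp add: linear_sum[OF assms] linear_scale[OF assms])
  then show ?thesis
    using basis_expansion[of v] by (simp add: scalar_mult_eq_scaleR)
qed

text \<open>A product rule that asks for derivatives only at fixed basis vectors, obtained by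
  expanding \<open>Y\<close> in coordinates. No topology on the space of linear maps is involved,
  and \<open>T x\<close> has to be linear only near the point.\<close>

lemma has_derivative_linear_family:
  fixes T :: "'a::real_normed_vector \<Rightarrow> real ^ 'k \<Rightarrow> 'b::real_normed_vector"
  assumes "open S" "x0 \<in> S"
    and lin: "\<And>x. x \<in> S \<Longrightarrow> linear (T x)" "\<And>a. linear (T' a)"
    and T: "\<And>k. ((\<lambda>x. T x (axis k 1)) has_derivative (\<lambda>a. T' a (axis k 1))) (at x0)"
    and Y: "(Y has_derivative Y') (at x0)"
  shows "((\<lambda>x. T x (Y x)) has_derivative (\<lambda>a. T x0 (Y' a) + T' a (Y x0))) (at x0)"
proof -
  have "((\<lambda>x. \<Sum>k\<in>UNIV. Y x $ k *\<^sub>R T x (axis k 1)) has_derivative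
      (\<lambda>a. \<Sum>k\<in>UNIV. Y x0 $ k *\<^sub>R T' a (axis k 1) + Y' a $ k *\<^sub>R T x0 (axis k 1))) (at x0)"
    by (intro has_derivative_sum has_derivative_scaleR T bounded_linear.has_derivative[OF bounded_linear_vec_nth] Y)
  then have "((\<lambda>x. T x (Y x)) has_derivative
      (\<lambda>a. \<Sum>k\<in>UNIV. Y x0 $ k *\<^sub>R T' a (axis k 1) + Y' a $ k *\<^sub>R T x0 (axis k 1))) (at x0)"
    by (rule has_derivative_transform_within_open[OF _ assms(1,2)])
      (simp add: linear_basis_expand[OF lin(1), symmetric])
  moreover have "(\<Sum>k\<in>UNIV. Y x0 $ k *\<^sub>R T' a (axis k 1) + Y' a $ k *\<^sub>R T x0 (axis k 1)) =
      T x0 (Y' a) + T' a (Y x0)" for a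
    using assms(2) by (simp add: sum.distrib linear_basis_expand[OF lin(1), symmetric]
        linear_basis_expand[OF lin(2), symmetric])
  ultimately show ?thesis by simp
qed

lemma differentiable_det:
  fixes A :: "'a::real_normed_vector \<Rightarrow> 'n::finite \<Rightarrow> 'n \<Rightarrow> real"
  assumes "\<And>i j. (\<lambda>x. A x i j) differentiable (at x0)"
  shows "(\<lambda>x. det (\<chi> i j. A x i j)) differentiable (at x0)"
proof -
  obtain A' where A': "\<And>i j. ((\<lambda>x. A x i j) has_derivative A' i j) (at x0)"
    using assms unfolding differentiable_def by metis
  have "(\<lambda>x. \<Prod>i\<in>UNIV. A x i (p i)) differentiable (at x0)" for p
    unfolding differentiable_def by (rule exI, rule has_derivative_prod, rule A')
  then show ?thesis
    unfolding det_def by (simp add: differentiable_sum differentiable_mult)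
qed

text \<open>A geometric structure read in the chart around one point. The metric varies over the
  open set \<open>S\<close>, while \<open>\<gamma>\<close> is the connection frozen at the point,
  because it is never differentiated. \<open>compatible\<close> collects all directions
  \<open>a\<close> in one Frechet derivative.\<close>

locale compatible_metric_family =
  fixes g :: "'n::{finite, linorder} canonical \<Rightarrow> 'n canonical \<Rightarrow> 'n canonical"
    and \<gamma> :: "'n canonical \<Rightarrow> 'n canonical \<Rightarrow> 'n canonical"
    and S :: "'n canonical set" and x0 :: "'n canonical"
  assumes open_S: "open S" and x0_S: "x0 \<in> S"
    and linear_g: "x \<in> S \<Longrightarrow> linear (g x)"
    and adjoint_g: "x \<in> S \<Longrightarrow> adjoint (g x) = g x"
    and det_g: "x \<in> S \<Longrightarrow> det (matrix (g x)) \<noteq> 0"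
    and linear_\<gamma>: "linear (\<gamma> a)"
    and compatible: "((\<lambda>x. g x b) has_derivative (\<lambda>a. g x0 (\<gamma> a b) + adjoint (\<gamma> a) (g x0 b))) (at x0)"
begin

abbreviation h where "h x \<equiv> inv (g x)"
abbreviation N where "N a \<equiv> adjoint (conn_ext (\<gamma> a))"

lemmas inverse_g = inverse_selfadjoint[OF linear_g adjoint_g det_g]

lemma g_h [simp]: "x \<in> S \<Longrightarrow> g x (h x b) = b"
  by (simp add: inverse_g(1) bij_is_surj surj_f_inv_f)

lemma h_g [simp]: "x \<in> S \<Longrightarrow> h x (g x b) = b"
  by (simp add: inverse_g(1) bij_is_inj)

lemma linear_N: "linear (N a)"
  by (simp add: adjoint_conn_ext linear_\<gamma> linear_conn_ext)

lemma N_wedge: "N a (vec1 v \<and>\<^sub>e X) = vec1 (adjoint (\<gamma> a) v) \<and>\<^sub>e X + vec1 v \<and>\<^sub>e N a X"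
  by (simp add: adjoint_conn_ext linear_\<gamma> conn_ext_wedge adjoint_linear)

lemma N_scalar [simp]: "N a (scalar c) = 0"
  by (simp add: adjoint_conn_ext linear_\<gamma>)

text \<open>Cramer's rule writes the inverse as quotients of determinants in the entries of
  \<open>g x\<close>. Existence is settled here so that the derivative can afterwards be solved
  for.\<close>

lemma differentiable_h: "(\<lambda>x. h x b) differentiable (at x0)"
proof -
  have entry: "(\<lambda>x. g x v $ i) differentiable (at x0)" for v i
    using bounded_linear.has_derivative[OF bounded_linear_vec_nth compatible]
    unfolding differentiable_def by blast
  have cramer': "h x b = (\<Sum>k\<in>UNIV. (det (\<chi> i j. if j = k then b $ i else g x (\<b> j) $ i) /
      det (\<chi> i j. g x (\<b> j) $ i)) *\<^sub>R \<b> k)" if "x \<in> S" for x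
  proof -
    have "matrix (g x) *v h x b = b"
      using that by (simp add: linear_g matrix_works)
    then have "h x b = (\<chi> k. det (\<chi> i j. if j = k then b $ i else matrix (g x) $ i $ j) / det (matrix (g x)))"
      using cramer[OF det_g[OF that]] by blast
    then show ?thesis
      using basis_expansion[of "h x b"] by (simp add: matrix_def scalar_mult_eq_scaleR cong: if_cong)
  qed
  have "(\<lambda>x. \<Sum>k\<in>UNIV. (det (\<chi> i j. if j = k then b $ i else g x (\<b> j) $ i) /
      det (\<chi> i j. g x (\<b> j) $ i)) *\<^sub>R \<b> k) differentiable (at x0)"
  proof (intro differentiable_sum ballI differentiable_scaleR differentiable_divide differentiable_det differentiable_const)
    show "(\<lambda>x. if j = k then b $ i else g x (\<b> j) $ i) differentiable at x0" for i j k
      using entry by (cases "j = k") simp_all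
    show "det (\<chi> i j. g x0 (\<b> j) $ i) \<noteq> 0"
      using det_g[OF x0_S] by (simp add: matrix_def)
  qed (auto intro: entry)
  then obtain D where "((\<lambda>x. \<Sum>k\<in>UNIV. (det (\<chi> i j. if j = k then b $ i else g x (\<b> j) $ i) /
      det (\<chi> i j. g x (\<b> j) $ i)) *\<^sub>R \<b> k) has_derivative D) (at x0)"
    unfolding differentiable_def by blast
  then have "((\<lambda>x. h x b) has_derivative D) (at x0)"
    by (rule has_derivative_transform_within_open[OF _ open_S x0_S]) (simp add: cramer')
  then show ?thesis
    unfolding differentiable_def by blast
qed

text \<open>Differentiate g (h b) = b with \<open>b\<close> fixed, insert \<open>compatible\<close>,
  and solve for the derivative of h b by applying \<open>h x0\<close>.\<close>

lemma has_derivative_h: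
  "((\<lambda>x. h x b) has_derivative (\<lambda>a. - \<gamma> a (h x0 b) - h x0 (adjoint (\<gamma> a) b))) (at x0)"
proof -
  obtain y' where y': "((\<lambda>x. h x b) has_derivative y') (at x0)"
    using differentiable_h unfolding differentiable_def by blast
  have "linear (\<lambda>b. g x0 (\<gamma> a b) + adjoint (\<gamma> a) (g x0 b))" for a
    using linear_compose[OF linear_\<gamma> linear_g[OF x0_S]] linear_compose[OF linear_g[OF x0_S] adjoint_linear[OF linear_\<gamma>]]
    by (auto simp: o_def intro: linear_compose_add)
  from has_derivative_linear_family[OF open_S x0_S linear_g this compatible y']
  have "((\<lambda>x. g x (h x b)) has_derivative
      (\<lambda>a. g x0 (y' a) + (g x0 (\<gamma> a (h x0 b)) + adjoint (\<gamma> a) (g x0 (h x0 b))))) (at x0)" .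
  then have "((\<lambda>x. b) has_derivative (\<lambda>a. g x0 (y' a) + (g x0 (\<gamma> a (h x0 b)) + adjoint (\<gamma> a) b))) (at x0)"
    by (rule has_derivative_transform_within_open[OF _ open_S x0_S, THEN has_derivative_eq_rhs]) (simp_all add: x0_S)
  then have "(\<lambda>a. g x0 (y' a) + (g x0 (\<gamma> a (h x0 b)) + adjoint (\<gamma> a) b)) = (\<lambda>a. 0)"
    by (rule has_derivative_unique[OF _ has_derivative_const])
  then have "g x0 (y' a) + (g x0 (\<gamma> a (h x0 b)) + adjoint (\<gamma> a) b) = 0" for a
    by (rule fun_cong)
  then have "g x0 (y' a) = - (g x0 (\<gamma> a (h x0 b)) + adjoint (\<gamma> a) b)" for a
    by (simp only: eq_neg_iff_add_eq_0)
  then have "g x0 (y' a) = - g x0 (\<gamma> a (h x0 b)) - adjoint (\<gamma> a) b" for a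
    by simp
  then have "h x0 (g x0 (y' a)) = h x0 (- g x0 (\<gamma> a (h x0 b)) - adjoint (\<gamma> a) b)" for a
    by simp
  then have "y' a = - \<gamma> a (h x0 b) - h x0 (adjoint (\<gamma> a) b)" for a
    by (simp add: x0_S linear_diff[OF inverse_g(2)] linear_neg[OF inverse_g(2)])
  then have "y' = (\<lambda>a. - \<gamma> a (h x0 b) - h x0 (adjoint (\<gamma> a) b))" by (rule ext)
  with y' show ?thesis by simp
qed

text \<open>Metric compatibility lifted from vectors to multivectors: the extension of
  \<open>g\<close> is multiplicative while \<open>N a\<close> and
  \<open>conn_ext (\<gamma> a)\<close> are derivations, so the identity propagates through each
  wedge factor.\<close>

lemma has_derivative_ext_alg:
  "((\<lambda>x. ext_alg (g x) X) has_derivative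
     (\<lambda>a. N a (ext_alg (g x0) X) + ext_alg (g x0) (conn_ext (\<gamma> a) X))) (at x0)"
proof -
  note lin = linear_ext_alg linear_N linear_conn_ext
  have "X \<in> {X. ((\<lambda>x. ext_alg (g x) X) has_derivative
     (\<lambda>a. N a (ext_alg (g x0) X) + ext_alg (g x0) (conn_ext (\<gamma> a) X))) (at x0)}"
  proof (rule multivector_induct, goal_cases)
    case 1
    show ?case
      unfolding subspace_def
    proof (intro conjI ballI allI CollectI, goal_cases)
      case 1
      show ?case by (simp add: lin[THEN linear_0])
    next
      case (2 X Y)
      show ?case
        using has_derivative_add[OF 2[THEN CollectD]] by (simp add: lin[THEN linear_add] algebra_simps)
    next
      case (3 c X)
      show ?case
        using has_derivative_scaleR_right[OF 3[THEN CollectD], of c]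
        by (simp add: lin[THEN linear_scale] algebra_simps)
    qed
  next
    case 2
    show ?case by (simp add: linear_0[OF linear_ext_alg])
  next
    case (3 i X)
    have "((\<lambda>x. vec1 (g x (\<b> i)) \<and>\<^sub>e ext_alg (g x) X) has_derivative
        (\<lambda>a. vec1 (g x0 (\<b> i)) \<and>\<^sub>e (N a (ext_alg (g x0) X) + ext_alg (g x0) (conn_ext (\<gamma> a) X)) +
             vec1 (g x0 (\<gamma> a (\<b> i)) + adjoint (\<gamma> a) (g x0 (\<b> i))) \<and>\<^sub>e ext_alg (g x0) X)) (at x0)"
      by (rule bounded_bilinear.FDERIV[OF bounded_bilinear_vec1_wedge compatible 3[THEN CollectD]])
    then have "((\<lambda>x. ext_alg (g x) (vec1 (\<b> i) \<and>\<^sub>e X)) has_derivative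
        (\<lambda>a. vec1 (g x0 (\<b> i)) \<and>\<^sub>e (N a (ext_alg (g x0) X) + ext_alg (g x0) (conn_ext (\<gamma> a) X)) +
             vec1 (g x0 (\<gamma> a (\<b> i)) + adjoint (\<gamma> a) (g x0 (\<b> i))) \<and>\<^sub>e ext_alg (g x0) X)) (at x0)"
      by (rule has_derivative_transform_within_open[OF _ open_S x0_S]) (simp add: ext_alg_wedge linear_g)
    moreover have "vec1 (g x0 (\<b> i)) \<and>\<^sub>e (N a (ext_alg (g x0) X) + ext_alg (g x0) (conn_ext (\<gamma> a) X)) +
             vec1 (g x0 (\<gamma> a (\<b> i)) + adjoint (\<gamma> a) (g x0 (\<b> i))) \<and>\<^sub>e ext_alg (g x0) X =
        N a (ext_alg (g x0) (vec1 (\<b> i) \<and>\<^sub>e X)) + ext_alg (g x0) (conn_ext (\<gamma> a) (vec1 (\<b> i) \<and>\<^sub>e X))" for a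
      by (simp add: ext_alg_wedge linear_g x0_S N_wedge conn_ext_wedge linear_\<gamma> linear_add[OF linear_ext_alg]
          linear_add[OF linear_wedge(1)] linear_add[OF linear_wedge(2)] linear_add[OF linear_vec1])
    ultimately show ?case by simp
  qed
  then show ?thesis by simp
qed

text \<open>On the top blade \<open>N a\<close> and \<open>conn_ext (\<gamma> a)\<close> multiply by
  the same \<open>c a\<close>, so the determinant has derivative 2 c d. The square root halves this
  to c, which is again the action of \<open>N a\<close>.\<close>

lemma has_derivative_sqrt_det:
  "((\<lambda>x. sqrt \<bar>det (matrix (g x))\<bar> *\<^sub>R axis UNIV 1) has_derivative
     (\<lambda>a. N a (sqrt \<bar>det (matrix (g x0))\<bar> *\<^sub>R axis UNIV 1))) (at x0)"
proof -
  define c where "c a = conn_ext (\<gamma> a) (axis UNIV 1) $ UNIV" for a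
  define d where "d x = det (matrix (g x))" for x
  have d0: "d x0 \<noteq> 0" using det_g[OF x0_S] by (simp add: d_def)
  have Nc: "N a (axis UNIV 1) = c a *\<^sub>R axis UNIV 1" and conn_ext_c: "conn_ext (\<gamma> a) (axis UNIV 1) = c a *\<^sub>R axis UNIV 1" for a
    unfolding c_def by (rule adjoint_conn_ext_pseudoscalar[OF linear_\<gamma>], rule conn_ext_pseudoscalar)
  have d': "(d has_derivative (\<lambda>a. 2 * c a * d x0)) (at x0)"
    using bounded_linear.has_derivative[OF bounded_linear_vec_nth has_derivative_ext_alg[of "axis UNIV 1"], of UNIV]
    by (simp add: ext_alg_pseudoscalar d_def[abs_def] mult.assoc linear_scale[OF linear_N] Nc conn_ext_c linear_scale[OF linear_ext_alg])
  \<comment> \<open>Writing |d| as the root of d * d lets the chain rule treat both signs of the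
    determinant at once.\<close>
  have "((\<lambda>x. sqrt (sqrt (d x * d x))) has_derivative (\<lambda>a. c a * sqrt \<bar>d x0\<bar>)) (at x0)"
  proof -
    have pos: "d x0 * d x0 > 0" "sqrt (d x0 * d x0) > 0"
      using d0 by (auto simp: zero_less_mult_iff)
    define r where "r = sqrt \<bar>d x0\<bar>"
    have r: "\<bar>d x0\<bar> = r * r" "d x0 * d x0 = r * r * (r * r)" "r > 0"
      using d0 by (simp_all add: r_def)
    have "((\<lambda>y. sqrt (sqrt (y * y))) has_real_derivative d x0 / (2 * (r * r * r))) (at (d x0))"
    proof -
      have "((\<lambda>y. y * y) has_real_derivative 2 * d x0) (at (d x0))"
        by (rule derivative_eq_intros refl)+ simp
      from DERIV_chain2[OF DERIV_real_sqrt[OF pos(1)] this]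
      have "((\<lambda>y. sqrt (y * y)) has_real_derivative inverse (sqrt (d x0 * d x0)) / 2 * (2 * d x0)) (at (d x0))" .
      moreover have "inverse (sqrt (d x0 * d x0)) / 2 * (2 * d x0) = d x0 / (r * r)"
        by (simp add: r(1) field_simps)
      ultimately have "((\<lambda>y. sqrt (y * y)) has_real_derivative d x0 / (r * r)) (at (d x0))"
        by simp
      from DERIV_chain2[OF DERIV_real_sqrt[OF pos(2)] this]
      have "((\<lambda>y. sqrt (sqrt (y * y))) has_real_derivative inverse (sqrt (sqrt (d x0 * d x0))) / 2 * (d x0 / (r * r)))
          (at (d x0))" .
      moreover have "inverse (sqrt (sqrt (d x0 * d x0))) / 2 * (d x0 / (r * r)) = d x0 / (2 * (r * r * r))"
        using r(3) by (simp add: r_def[symmetric] field_simps)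
      ultimately show ?thesis by simp
    qed
    then have "((\<lambda>x. sqrt (sqrt (d x * d x))) has_derivative (\<lambda>a. 2 * c a * d x0 * (d x0 / (2 * (r * r * r))))) (at x0)"
      by (rule DERIV_compose_FDERIV[OF _ d'])
    moreover have "2 * c a * d x0 * (d x0 / (2 * (r * r * r))) = c a * sqrt \<bar>d x0\<bar>" for a
      using r(2,3) by (simp add: r_def[symmetric] field_simps)
    ultimately show ?thesis by simp
  qed
  then have "((\<lambda>x. sqrt (sqrt (d x * d x)) *\<^sub>R axis UNIV (1::real)) has_derivative
      (\<lambda>a. (c a * sqrt \<bar>d x0\<bar>) *\<^sub>R axis UNIV 1)) (at x0)"
    by (rule has_derivative_scaleR_left)
  then show ?thesis
    by (simp add: d_def[symmetric] linear_scale[OF linear_N] Nc mult.commute)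
qed

text \<open>Left multiplication by the pseudoscalar and the Hodge map are both of this form; the covariant
  derivative is \<open>\<partial> - N\<close>.\<close>
lemma has_derivative_contraction_family:
  assumes lin: "\<And>x. x \<in> S \<Longrightarrow> linear (T x)"
    and wedge: "\<And>x v X. x \<in> S \<Longrightarrow> T x (vec1 v \<and>\<^sub>e X) = \<epsilon> *\<^sub>R (vec1 (h x v) \<lrcorner> T x X)"
    and T1: "((\<lambda>x. T x (scalar 1)) has_derivative (\<lambda>a. N a (T x0 (scalar 1)))) (at x0)"
    and Y: "(Y has_derivative Y') (at x0)"
  shows "((\<lambda>x. T x (Y x)) has_derivative
    (\<lambda>a. T x0 (Y' a - N a (Y x0)) + N a (T x0 (Y x0)))) (at x0)"
proof -
  note linT = lin[OF x0_S]
  \<comment> \<open>For a constant \<open>X\<close>, D^- X is -N X, so this says that T commutes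
    with D^- on constant fields.\<close>
  have T: "((\<lambda>x. T x X) has_derivative (\<lambda>a. N a (T x0 X) - T x0 (N a X))) (at x0)" for X
  proof -
    have "X \<in> {X. ((\<lambda>x. T x X) has_derivative (\<lambda>a. N a (T x0 X) - T x0 (N a X))) (at x0)}"
    proof (rule multivector_induct, goal_cases)
      case 1
      show ?case
        unfolding subspace_def
      proof (intro conjI ballI allI CollectI, goal_cases)
        case 1
        have "((\<lambda>x. 0) has_derivative (\<lambda>a. 0)) (at x0)" by simp
        then have "((\<lambda>x. T x 0) has_derivative (\<lambda>a. 0)) (at x0)"
          by (rule has_derivative_transform_within_open[OF _ open_S x0_S]) (simp add: lin[THEN linear_0])
        then show ?case by (simp add: linear_0[OF linT] linear_0[OF linear_N])
      next
        case (2 X Y)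
        have "((\<lambda>x. T x (X + Y)) has_derivative
            (\<lambda>a. (N a (T x0 X) - T x0 (N a X)) + (N a (T x0 Y) - T x0 (N a Y)))) (at x0)"
          by (rule has_derivative_transform_within_open[OF has_derivative_add[OF 2[THEN CollectD]] open_S x0_S])
            (simp add: lin[THEN linear_add])
        then show ?case by (simp add: linear_add[OF linT] linear_add[OF linear_N] algebra_simps)
      next
        case (3 c X)
        have "((\<lambda>x. T x (c *\<^sub>R X)) has_derivative (\<lambda>a. c *\<^sub>R (N a (T x0 X) - T x0 (N a X)))) (at x0)"
          by (rule has_derivative_transform_within_open[OF has_derivative_scaleR_right[OF 3[THEN CollectD]] open_S x0_S])
            (simp add: lin[THEN linear_scale])
        then show ?case by (simp add: linear_scale[OF linT] linear_scale[OF linear_N] algebra_simps)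
      qed
    next
      case 2
      show ?case using T1 by (simp add: linear_0[OF linT])
    next
      case (3 i X)
      have "((\<lambda>x. \<epsilon> *\<^sub>R (vec1 (h x (\<b> i)) \<lrcorner> T x X)) has_derivative
          (\<lambda>a. \<epsilon> *\<^sub>R (vec1 (h x0 (\<b> i)) \<lrcorner> (N a (T x0 X) - T x0 (N a X)) +
             vec1 (- \<gamma> a (h x0 (\<b> i)) - h x0 (adjoint (\<gamma> a) (\<b> i))) \<lrcorner> T x0 X))) (at x0)"
        by (intro has_derivative_scaleR_right
            bounded_bilinear.FDERIV[OF bounded_bilinear_vec1_lcontr has_derivative_h 3[THEN CollectD]])
      then have "((\<lambda>x. T x (vec1 (\<b> i) \<and>\<^sub>e X)) has_derivative
          (\<lambda>a. \<epsilon> *\<^sub>R (vec1 (h x0 (\<b> i)) \<lrcorner> (N a (T x0 X) - T x0 (N a X)) +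
             vec1 (- \<gamma> a (h x0 (\<b> i)) - h x0 (adjoint (\<gamma> a) (\<b> i))) \<lrcorner> T x0 X))) (at x0)"
        by (rule has_derivative_transform_within_open[OF _ open_S x0_S]) (simp add: wedge)
      \<comment> \<open>Of the two terms in the derivative of \<open>h\<close>, the one with
        \<open>\<gamma> a\<close> is the commutator of \<open>N a\<close> with the contraction, and
        the one with its adjoint comes from \<open>N a\<close> acting on the vector inside
        T.\<close>
      moreover have "\<epsilon> *\<^sub>R (vec1 (h x0 (\<b> i)) \<lrcorner> (N a (T x0 X) - T x0 (N a X)) +
             vec1 (- \<gamma> a (h x0 (\<b> i)) - h x0 (adjoint (\<gamma> a) (\<b> i))) \<lrcorner> T x0 X) =
          N a (T x0 (vec1 (\<b> i) \<and>\<^sub>e X)) - T x0 (N a (vec1 (\<b> i) \<and>\<^sub>e X))" for a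
        by (simp add: N_wedge wedge x0_S linear_add[OF linT] linear_scale[OF linear_N] linear_diff[OF linear_lcontr]
            conn_ext_adjoint_lcontr linear_\<gamma> linear_diff[OF linear_lcontr_vec1] linear_neg[OF linear_lcontr_vec1]
            algebra_simps)
      ultimately show ?case by simp
    qed
    then show ?thesis by simp
  qed
  have "linear (\<lambda>X. N a (T x0 X) - T x0 (N a X))" for a
    using linear_compose[OF linT linear_N] linear_compose[OF linear_N linT]
    by (auto simp: o_def intro: linear_compose_sub)
  from has_derivative_linear_family[OF open_S x0_S lin this T Y]
  show ?thesis by (simp add: linear_diff[OF linT] algebra_simps)
qed

end

section \<open>Passing to the chart\<close>

lemma dir_deriv_eq:
  assumes "(chart_repr c f has_derivative f') (at (snd c p))"
  shows "dir_deriv c a f p = f' a"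
proof -
  have f': "frechet_derivative (chart_repr c f) (at (snd c p)) = f'"
    using assms by (metis frechet_derivative_at)
  have "f' (\<Sum>\<mu>\<in>UNIV. (a \<bullet> \<b> \<mu>) *\<^sub>R \<b> \<mu>) = (\<Sum>\<mu>\<in>UNIV. (a \<bullet> \<b> \<mu>) *\<^sub>R f' (\<b> \<mu>))"
    using has_derivative_linear[OF assms] by (simp add: linear_sum linear_scale)
  moreover have "(\<Sum>\<mu>\<in>UNIV. (a \<bullet> \<b> \<mu>) *\<^sub>R \<b> \<mu>) = a"
    using basis_expansion[of a] by (simp add: scalar_mult_eq_scaleR inner_axis)
  ultimately show ?thesis
    by (simp add: dir_deriv_def partial_deriv_def f')
qed

lemma smooth_map_differentiable:
  assumes "smooth_map \<A> U f" "(W, \<psi>) \<in> \<A>" "U \<subseteq> W" "p \<in> U"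
  shows "chart_repr (W, \<psi>) f differentiable (at (\<psi> p))"
proof -
  have "smooth_on (\<psi> ` (U \<inter> W)) (chart_repr (W, \<psi>) f)"
    using assms(1,2) by (force simp: smooth_map_def)
  then have "Ck_on (Suc 0) (\<psi> ` (U \<inter> W)) (chart_repr (W, \<psi>) f)"
    unfolding smooth_on_def by blast
  then show ?thesis using assms(3,4) by auto
qed

lemma is_chart_image:
  assumes "is_chart (W, \<psi>)" "open U" "U \<subseteq> W"
  shows "open (\<psi> ` U)" and "p \<in> U \<Longrightarrow> inv_into W \<psi> (\<psi> p) = p"
proof -
  have W: "open (\<psi> ` W)" "homeomorphism W (\<psi> ` W) \<psi> (inv_into W \<psi>)"
    using assms(1) by (auto simp: is_chart_def)
  have "openin (top_of_set W) U"
    using assms by (simp add: openin_open_eq is_chart_def)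
  then have "openin (top_of_set (\<psi> ` W)) (\<psi> ` U)"
    by (rule homeomorphism_imp_open_map[OF W(2)])
  then show "open (\<psi> ` U)"
    using W(1) by (simp add: openin_open_eq)
  show "p \<in> U \<Longrightarrow> inv_into W \<psi> (\<psi> p) = p"
    using W(2) assms(3) by (auto simp: homeomorphism_def)
qed

section \<open>Local constancy of the frame orientation\<close>

lemma isCont_wedge_list:
  fixes f :: "'i \<Rightarrow> 'a::t2_space \<Rightarrow> 'n::{finite, linorder} canonical"
  assumes "\<And>i. isCont (f i) x0"
  shows "isCont (\<lambda>x. wedge_list (map (\<lambda>i. f i x) is)) x0"
  by (induction "is")
    (use assms in \<open>auto simp: wedge_list_Cons intro: bounded_bilinear.continuous[OF bounded_bilinear_vec1_wedge]\<close>)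

lemma eventually_sgn_eq:
  fixes w :: "'a::t2_space \<Rightarrow> real"
  assumes "isCont w x0" "w x0 \<noteq> 0"
  shows "\<forall>\<^sub>F x in at x0. sgn (w x) = sgn (w x0)"
proof (cases "w x0 > 0")
  case True
  then have "\<forall>\<^sub>F x in at x0. w x > 0"
    using assms(1) by (auto simp: isCont_def dest: order_tendstoD)
  then show ?thesis using True by (auto elim: eventually_mono)
next
  case False
  then have "w x0 < 0" using assms(2) by simp
  then have "\<forall>\<^sub>F x in at x0. w x < 0"
    using assms(1) by (auto simp: isCont_def dest: order_tendstoD)
  then show ?thesis using \<open>w x0 < 0\<close> by (auto elim: eventually_mono)
qed

theorem mainTheorem16:
  fixes \<A> :: "('m::{t2_space, second_countable_topology}, 'n::{finite, linorder}) chart set"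
    and U\<^sub>o U :: "'m set"
    and \<phi>\<^sub>o :: "'m \<Rightarrow> 'n canonical"
    and g :: "'m \<Rightarrow> 'n canonical \<Rightarrow>\<^sub>L 'n canonical"
    and \<gamma> :: "'m \<Rightarrow> 'n canonical \<Rightarrow>\<^sub>L 'n canonical \<Rightarrow>\<^sub>L 'n canonical"
    and Dp Dm :: "'n canonical \<Rightarrow> ('m \<Rightarrow> 'n multivector) \<Rightarrow> 'm \<Rightarrow> 'n multivector"
    and e e' :: "'n \<Rightarrow> 'm \<Rightarrow> 'n canonical"
    and X :: "'m \<Rightarrow> 'n multivector"
  assumes "smooth_atlas \<A>" and "(U\<^sub>o, \<phi>\<^sub>o) \<in> \<A>" and "open U" and "U \<subseteq> U\<^sub>o"
    and "geometric_structure \<A> (U\<^sub>o, \<phi>\<^sub>o) U \<gamma> g"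
    and "Dp = cov_plus (U\<^sub>o, \<phi>\<^sub>o) \<gamma>" and "Dm = cov_minus (U\<^sub>o, \<phi>\<^sub>o) \<gamma>"
    and "reciprocal_frames \<A> U e e'"
    and "smooth_map \<A> U X"
  shows "(\<forall>p\<in>U. clifford (inv_metric g p) (metric_volume g e e' p) (cov_curl Dm X p) =
            (- 1) ^ (CARD('n) + 1) *\<^sub>R
              metric_divergence g Dm
                (\<lambda>q. clifford (inv_metric g q) (metric_volume g e e' q) (X q)) p)
       \<and> (\<forall>p\<in>U. inv (metric_hodge g e e' p)
                   (cov_curl Dm (\<lambda>q. metric_hodge g e e' q (X q)) p) =
                - metric_divergence g Dm (\<lambda>q. grade_inv (X q)) p)"
proof -
  define \<psi> where "\<psi> = inv_into U\<^sub>o \<phi>\<^sub>o"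
  have repr: "chart_repr (U\<^sub>o, \<phi>\<^sub>o) f = (\<lambda>x. f (\<psi> x))" for f :: "'m \<Rightarrow> 'z"
    by (simp add: chart_repr_def \<psi>_def o_def)
  have chart: "is_chart (U\<^sub>o, \<phi>\<^sub>o)"
    using assms(1,2) by (auto simp: smooth_atlas_def)
  define S where "S = \<phi>\<^sub>o ` U"
  have S: "open S" and \<psi>: "\<And>p. p \<in> U \<Longrightarrow> \<psi> (\<phi>\<^sub>o p) = p"
    using is_chart_image[OF chart assms(3,4)] by (simp_all add: S_def \<psi>_def)
  then have \<psi>_S: "\<psi> x \<in> U" if "x \<in> S" for x
    using that by (auto simp: S_def)
  note diff = smooth_map_differentiable[OF _ assms(2,4), unfolded repr]
  have g: "smooth_map \<A> U g"
    and g_adj: "\<And>p. p \<in> U \<Longrightarrow> adjoint (blinfun_apply (g p)) = blinfun_apply (g p)"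
    and g_det: "\<And>p. p \<in> U \<Longrightarrow> det (matrix (blinfun_apply (g p))) \<noteq> 0"
    and g_compat: "\<And>p a b. p \<in> U \<Longrightarrow> g p (\<gamma> p a b) + adjoint (blinfun_apply (\<gamma> p a)) (g p b) =
        endo_dir_deriv (U\<^sub>o, \<phi>\<^sub>o) a g (\<lambda>_. b) p"
    using assms(5) by (auto simp: geometric_structure_def metric_field_def)
  have lin: "linear (blinfun_apply L)" for L :: "'n canonical \<Rightarrow>\<^sub>L 'n canonical"
    by (simp add: blinfun.bounded_linear_right bounded_linear.linear)
  note inv_g = inverse_selfadjoint[OF lin g_adj g_det]
  have frames: "\<And>p \<mu> \<nu>. p \<in> U \<Longrightarrow> e \<mu> p \<bullet> e' \<nu> p = (if \<mu> = \<nu> then 1 else 0)"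
    and e': "\<And>\<mu>. smooth_map \<A> U (e' \<mu>)"
    using assms(8) by (auto simp: reciprocal_frames_def)
  have \<tau>_ps: "\<exists>c. c \<noteq> 0 \<and> metric_volume g e e' p = c *\<^sub>R axis UNIV 1" if "p \<in> U" for p
    using volume_eq_sgn[of e p e', OF frames[OF that]] g_det[OF that]
    by (intro exI[of _ "sqrt \<bar>det (matrix (blinfun_apply (g p)))\<bar> * sgn (wedge_all (\<lambda>\<mu>. e' \<mu> p) $ UNIV)"])
      (simp add: metric_volume_def sgn_zero_iff)
  have "clifford (inv_metric g p) (metric_volume g e e' p) (cov_curl Dm X p) =
        (- 1) ^ (CARD('n) + 1) *\<^sub>R
          metric_divergence g Dm (\<lambda>q. clifford (inv_metric g q) (metric_volume g e e' q) (X q)) p \<and>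
      inv (metric_hodge g e e' p) (cov_curl Dm (\<lambda>q. metric_hodge g e e' q (X q)) p) =
        - metric_divergence g Dm (\<lambda>q. grade_inv (X q)) p" if p: "p \<in> U" for p
  proof -
    define x0 where "x0 = \<phi>\<^sub>o p"
    have x0: "x0 \<in> S" "\<psi> x0 = p" using p by (simp_all add: x0_def S_def \<psi>)
    \<comment> \<open>For a constant field \<open>b\<close> the correction term in
      \<open>endo_dir_deriv\<close> vanishes, so the compatibility condition is literally the
      derivative of \<open>g\<close> applied to \<open>b\<close>.\<close>
    have dg: "((\<lambda>x. g (\<psi> x) b) has_derivative
        (\<lambda>a. g (\<psi> x0) (\<gamma> p a b) + adjoint (blinfun_apply (\<gamma> p a)) (g (\<psi> x0) b))) (at x0)" for b
    proof -
      obtain g' where "((\<lambda>x. g (\<psi> x)) has_derivative g') (at x0)"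
        using diff[OF g p] unfolding x0_def differentiable_def by blast
      then have d: "((\<lambda>x. g (\<psi> x) b) has_derivative (\<lambda>a. g' a b)) (at x0)"
        by (rule bounded_linear.has_derivative[OF blinfun.bounded_linear_left])
      have "dir_deriv (U\<^sub>o, \<phi>\<^sub>o) a (\<lambda>q. g q b) p = g' a b" for a
        by (rule dir_deriv_eq) (use d in \<open>simp add: repr x0_def\<close>)
      moreover have "dir_deriv (U\<^sub>o, \<phi>\<^sub>o) a (\<lambda>q. b) p = 0" for a
        by (rule dir_deriv_eq[where f' = "\<lambda>_. 0"]) (simp add: repr)
      ultimately have "g' a b = g p (\<gamma> p a b) + adjoint (blinfun_apply (\<gamma> p a)) (g p b)" for a
        using g_compat[OF p, of a b] by (simp add: endo_dir_deriv_def)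
      with d show ?thesis by (simp add: x0)
    qed
    interpret compatible_metric_family "\<lambda>x. blinfun_apply (g (\<psi> x))" "\<lambda>a. blinfun_apply (\<gamma> p a)" S x0
      by (rule compatible_metric_family.intro) (rule S x0(1) lin dg g_adj g_det \<psi>_S | assumption)+
    have \<tau>: "((\<lambda>x. metric_volume g e e' (\<psi> x)) has_derivative (\<lambda>a. N a (metric_volume g e e' (\<psi> x0)))) (at x0)"
    proof -
      define w where "w x = wedge_all (\<lambda>\<mu>. e' \<mu> (\<psi> x)) $ UNIV" for x
      have "isCont (\<lambda>x. e' \<mu> (\<psi> x)) x0" for \<mu>
        using diff[OF e' p] unfolding x0_def by (rule differentiable_imp_continuous_within)
      then have "isCont w x0"
        unfolding w_def[abs_def] wedge_all_def by (intro isCont_vec_nth isCont_wedge_list)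
      moreover have vol: "volume e e' (\<psi> x) = sgn (w x) *\<^sub>R axis UNIV 1" "w x \<noteq> 0" if "x \<in> S" for x
        using volume_eq_sgn[of e "\<psi> x" e', OF frames[OF \<psi>_S[OF that]]] by (simp_all add: w_def)
      ultimately have "\<forall>\<^sub>F x in at x0. sgn (w x) = sgn (w x0)"
        using x0(1) by (intro eventually_sgn_eq)
      moreover have "\<forall>\<^sub>F x in at x0. x \<in> S"
        using S x0(1) by (rule eventually_at_in_open')
      \<comment> \<open>Near the point the orientation sign is frozen at its value there, leaving a
        constant multiple of the function treated in \<open>has_derivative_sqrt_det\<close>.\<close>
      ultimately have ev: "\<forall>\<^sub>F x in at x0. sgn (w x0) *\<^sub>R (sqrt \<bar>det (matrix (blinfun_apply (g (\<psi> x))))\<bar> *\<^sub>R axis UNIV 1) =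
          metric_volume g e e' (\<psi> x)"
        by eventually_elim (simp add: metric_volume_def vol)
      have eq: "metric_volume g e e' (\<psi> x0) = sgn (w x0) *\<^sub>R (sqrt \<bar>det (matrix (blinfun_apply (g (\<psi> x0))))\<bar> *\<^sub>R axis UNIV 1)"
        using x0(1) by (simp add: metric_volume_def vol)
      have "((\<lambda>x. metric_volume g e e' (\<psi> x)) has_derivative
          (\<lambda>a. sgn (w x0) *\<^sub>R N a (sqrt \<bar>det (matrix (blinfun_apply (g (\<psi> x0))))\<bar> *\<^sub>R axis UNIV 1))) (at x0)"
        by (rule has_derivative_transform_eventually[OF has_derivative_scaleR_right[OF has_derivative_sqrt_det] ev])
          (simp_all add: eq)
      then show ?thesis
        unfolding eq by (simp only: linear_scale[OF linear_N])
    qed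
    have Dm_eq: "Dm a Y p = Y' a - N a (Y p)"
      if "((\<lambda>x. Y (\<psi> x)) has_derivative Y') (at x0)" for a Y Y'
      using dir_deriv_eq[of "(U\<^sub>o, \<phi>\<^sub>o)" Y Y' p a] that by (simp add: assms(7) cov_minus_def repr x0_def)
    \<comment> \<open>The -N in D^- cancels the N (T Y) left over by
      \<open>has_derivative_contraction_family\<close>.\<close>
    have Dm_family: "Dm a (\<lambda>q. T q (Y q)) p = T p (Dm a Y p)"
      if T: "\<And>q. q \<in> U \<Longrightarrow> linear (T q)"
        "\<And>q v X. q \<in> U \<Longrightarrow> T q (vec1 v \<and>\<^sub>e X) = \<epsilon> *\<^sub>R (vec1 (inv_metric g q v) \<lrcorner> T q X)"
        "\<And>q. q \<in> U \<Longrightarrow> T q (scalar 1) = metric_volume g e e' q"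
        and Y: "(\<lambda>x. Y (\<psi> x)) differentiable (at x0)" for T Y \<epsilon> a
    proof -
      obtain Y' where Y': "((\<lambda>x. Y (\<psi> x)) has_derivative Y') (at x0)"
        using Y unfolding differentiable_def by blast
      have T1: "((\<lambda>x. T (\<psi> x) (scalar 1)) has_derivative (\<lambda>a. N a (T (\<psi> x0) (scalar 1)))) (at x0)"
        by (rule has_derivative_transform_within_open[OF \<tau> S x0(1), THEN has_derivative_eq_rhs])
          (simp_all add: T(3) \<psi>_S x0(1))
      have "((\<lambda>x. T (\<psi> x) (Y (\<psi> x))) has_derivative
          (\<lambda>a. T (\<psi> x0) (Y' a - N a (Y (\<psi> x0))) + N a (T (\<psi> x0) (Y (\<psi> x0))))) (at x0)"
        by (rule has_derivative_contraction_family[of "\<lambda>x. T (\<psi> x)" \<epsilon>, OF _ _ T1 Y']) (simp_all add: T(1,2) \<psi>_S)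
      from Dm_eq[of "\<lambda>q. T q (Y q)", OF this] show ?thesis
        by (simp add: Dm_eq[OF Y'] x0(2))
    qed
    obtain X' where X': "((\<lambda>x. X (\<psi> x)) has_derivative X') (at x0)"
      using diff[OF assms(9) p] unfolding x0_def differentiable_def by blast
    have grade: "((\<lambda>x. grade_scale \<sigma> (X (\<psi> x))) has_derivative (\<lambda>a. grade_scale \<sigma> (X' a))) (at x0)" for \<sigma>
      using X' by (rule bounded_linear.has_derivative[OF linear_grade_scale[unfolded linear_conv_bounded_linear]])
    then have grade_diff: "(\<lambda>x. grade_scale \<sigma> (X (\<psi> x))) differentiable (at x0)" for \<sigma>
      unfolding differentiable_def by blast
    have Dm_grade: "Dm a (\<lambda>q. grade_scale \<sigma> (X q)) p = grade_scale \<sigma> (Dm a X p)" for a \<sigma>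
      using Dm_eq[of "\<lambda>q. grade_scale \<sigma> (X q)", OF grade]
      by (simp add: Dm_eq[OF X'] linear_diff[OF linear_grade_scale] adjoint_conn_ext_grade_scale)
    define s :: real where "s = (- 1) ^ (CARD('n) + 1)"
    have ss: "s * s = 1" by (simp add: s_def flip: power_mult_distrib)
    let ?C = "\<lambda>q. clifford (inv_metric g q) (metric_volume g e e' q)"
    have C: "is_clifford_product (inv_metric g q) (clifford (inv_metric g q))" if "q \<in> U" for q
      using inv_g[OF that that] by (intro is_clifford_product_clifford)
    have C_lcontr: "vec1 (inv_metric g q v) \<lrcorner> ?C q Y = s *\<^sub>R ?C q (vec1 v \<and>\<^sub>e Y)" if "q \<in> U" for q v Y
      using \<tau>_ps[OF that] lcontr_clifford_pseudoscalar[OF inv_g(2,3)[OF that that]]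
      unfolding s_def by blast
    have C_linear: "linear (?C q)" if "q \<in> U" for q
      using C[OF that] by (auto simp: is_clifford_product_def bilinear_def)
    have Dm_C: "Dm a (\<lambda>q. ?C q (X q)) p = ?C p (Dm a X p)" for a
    proof (rule Dm_family[of ?C s])
      show "?C q (scalar 1) = metric_volume g e e' q" if "q \<in> U" for q
        using C[OF that] by (simp add: is_clifford_product_def)
    qed (use C_linear X' in \<open>auto simp: C_lcontr ss differentiable_def\<close>)
    have 1: "?C p (cov_curl Dm X p) = (- 1) ^ (CARD('n) + 1) *\<^sub>R metric_divergence g Dm (\<lambda>q. ?C q (X q)) p"
    proof -
      have "s *\<^sub>R metric_divergence g Dm (\<lambda>q. ?C q (X q)) p =
          (\<Sum>\<mu>\<in>UNIV. s *\<^sub>R (s *\<^sub>R ?C p (vec1 (\<b> \<mu>) \<and>\<^sub>e Dm (\<b> \<mu>) X p)))"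
        unfolding metric_divergence_def Dm_C C_lcontr[OF p] by (rule scaleR_right.sum)
      also have "\<dots> = ?C p (cov_curl Dm X p)"
        by (simp add: cov_curl_def linear_sum[OF C_linear[OF p]] ss)
      finally show ?thesis unfolding s_def by (rule sym)
    qed
    \<comment> \<open>The extra reversion cancels the one inside the Hodge map, so that
      \<open>H\<close> satisfies the contraction rule with \<epsilon> = 1.\<close>
    define H where "H q Y = metric_hodge g e e' q (reversion Y)" for q Y
    have H: "H q Y = ext_alg (inv_metric g q) Y \<lrcorner> metric_volume g e e' q" if "q \<in> U" for q Y
      by (simp add: H_def metric_hodge_def inv_ext_alg[OF lin inv_g(1)[OF that that]])
    have H_linear: "linear (H q)" if "q \<in> U" for q
    proof -
      have "H q = (\<lambda>Y. ext_alg (inv_metric g q) Y \<lrcorner> metric_volume g e e' q)"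
        by (rule ext, rule H[OF that])
      then show ?thesis
        using linear_compose[OF linear_ext_alg linear_lcontr_left] by (simp add: o_def)
    qed
    have H_wedge: "vec1 v \<and>\<^sub>e H p Y = H p (vec1 (inv_metric g p v) \<lrcorner> Y)" for v Y
    proof -
      obtain c where "metric_volume g e e' p = c *\<^sub>R axis UNIV 1"
        using \<tau>_ps[OF p] by blast
      then show ?thesis
        unfolding H[OF p] by (rule wedge_lcontr_pseudoscalar[OF inv_g(2,3)[OF p p]])
    qed
    have hodge: "metric_hodge g e e' q Y = H q (reversion Y)" for q Y
      by (simp add: H_def)
    have Dm_hodge: "Dm a (\<lambda>q. metric_hodge g e e' q (X q)) p = H p (reversion (Dm a X p))" for a
      unfolding hodge using Dm_family[of H 1 "\<lambda>q. reversion (X q)" a] grade_diff inv_g(2)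
      by (simp add: H_linear H ext_alg_wedge lcontr_wedge scalar_lcontr Dm_grade reversion_eq_grade_scale)
    have H_inj: "Y = 0" if "H p Y = 0" for Y
    proof -
      obtain c where c: "c \<noteq> 0" "metric_volume g e e' p = c *\<^sub>R axis UNIV 1"
        using \<tau>_ps[OF p] by blast
      have "c *\<^sub>R (ext_alg (inv_metric g p) Y \<lrcorner> axis UNIV 1) = 0"
        using that unfolding H[OF p] c(2) linear_scale[OF linear_lcontr] .
      then have 0: "ext_alg (inv_metric g p) Y = 0"
        using c(1) by (simp add: lcontr_pseudoscalar_eq_0_iff)
      have "blinfun_apply (g p) \<circ> inv_metric g p = id"
        using bij_is_surj[OF inv_g(1)[OF p p]] unfolding surj_iff .
      then have "Y = ext_alg (blinfun_apply (g p)) (ext_alg (inv_metric g p) Y)"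
        unfolding ext_alg_compose[OF lin inv_g(2)[OF p p]] by (simp only: ext_alg_id)
      also have "\<dots> = 0"
        unfolding 0 by (rule linear_0[OF linear_ext_alg])
      finally show ?thesis .
    qed
    \<comment> \<open>Injectivity makes \<open>inv\<close> a genuine left inverse; it then suffices
      to exhibit the curl as a Hodge image.\<close>
    have "inj (metric_hodge g e e' p)"
    proof (rule injI)
      fix Y Z
      assume "metric_hodge g e e' p Y = metric_hodge g e e' p Z"
      then have "H p (reversion Y - reversion Z) = 0"
        by (simp add: hodge linear_diff[OF H_linear[OF p]])
      then have "reversion Y = reversion Z"
        using H_inj by force
      then show "Y = Z" by (metis reversion_reversion)
    qed
    moreover have "cov_curl Dm (\<lambda>q. metric_hodge g e e' q (X q)) p =
        metric_hodge g e e' p (- metric_divergence g Dm (\<lambda>q. grade_inv (X q)) p)"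
    proof -
      \<comment> \<open>Of the three grade involutions met here, two cancel around the reversion,
        and moving one past the contraction leaves the minus sign.\<close>
      have *: "reversion (vec1 v \<lrcorner> grade_inv Y) = - (vec1 v \<lrcorner> reversion Y)" for v and Y :: "'n multivector"
        by (simp add: reversion_lcontr_vec1 grade_inv_lcontr)
      have "Dm a (\<lambda>q. grade_inv (X q)) p = grade_inv (Dm a X p)" for a
        unfolding grade_inv_eq_grade_scale by (rule Dm_grade)
      then show ?thesis
        unfolding cov_curl_def metric_divergence_def Dm_hodge H_wedge
        by (simp add: hodge linear_neg[OF linear_reversion]
            linear_sum[OF linear_reversion] * linear_neg[OF H_linear[OF p]] linear_sum[OF H_linear[OF p]] sum_negf)
    qed
    ultimately have 2: "inv (metric_hodge g e e' p) (cov_curl Dm (\<lambda>q. metric_hodge g e e' q (X q)) p) =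
                - metric_divergence g Dm (\<lambda>q. grade_inv (X q)) p"
      by simp
    from 1 2 show ?thesis by (rule conjI)
  qed
  then show ?thesis by simp
qed

end
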